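(* (1) Let $Y=(Y_t)_{t\in T}$ be a Poissonian infinitely divisible process. Then there exist a unique Lévy measure $\nu$ on $(\mathbb{R}^T,\mathcal{B}^T)$ and a shift function $b\in\mathbb{R}^T$ such that for every $I\in\hat T$ and every $a=(a_t)_{t\in I}\in\mathbb{R}^I$ $$\mathbb{E}\exp\Big(i\sum_{t\in I}a_tY_t\Big)=\exp\Big\{\int_{\mathbb{R}^T}\Big(e^{i\langle a,x_I\rangle}-1-i\langle a,[[x_I]]\rangle\Big)\,\nu(dx)+i\langle a,b_I\rangle\Big\}.$$ (2) Therefore, for any consistent system of finite-dimensional Lévy measures $\{\nu_I: I\in\hat T\}$ there exists a unique Lévy measure $\nu$ on $(\mathbb{R}^T,\mathcal{B}^T)$ such that $$\nu\circ\pi_I^{-1}=\nu_I\quad\text{on }\mathcal{B}_0^I,\qquad I\in\hat T.$$ (3) Furthermore, in the situation of (2), if $\rho$ is a measure on $(\mathbb{R}^T,\mathcal{B}^T)$ such that $\rho\circ\pi_I^{-1}=\nu_I$ on $\mathcal{B}_0^I$ for all $I\in\hat T$, then $\nu=\rho^0\le\rho$, where $\rho^0(A):=\rho_*(A\setminus\{0_T\})$ for $A\in\mathcal{B}^T$.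
   Context: $T$ is an arbitrary nonempty set, $\mathbb{R}^T$ the space of all functions $x:T\to\mathbb{R}$, $\mathcal{B}^T$ its cylindrical (product) $\sigma$-algebra. For $S\subset T$, $x_S$ is the restriction of $x$ to $S$, $\pi_S:\mathbb{R}^T\to\mathbb{R}^S$, $\pi_S(x)=x_S$, and $0_S$ is the origin of $\mathbb{R}^S$. For $I\subset J$, $\pi_{IJ}:\mathbb{R}^J\to\mathbb{R}^I$ is the restriction map. $\hat T$ is the family of all finite nonempty subsets of $T$; $\mathbb{R}^I$, $I\in\hat T$, is identified with Euclidean space with inner product $\langle\cdot,\cdot\rangle$. $\mathcal{B}_0^S:=\{B\in\mathcal{B}^S:0_S\notin B\}$. For a measure $\nu$ on $(\mathbb{R}^T,\mathcal{B}^T)$ the inner measure is $\nu_*(E)=\sup\{\nu(D):D\subset E,\ D\in\mathcal{B}^T\}$. A measure $\nu$ on $(\mathbb{R}^T,\mathcal{B}^T)$ is a Lévy measure if (L1) $\int_{\mathbb{R}^T}|x(t)|^2\wedge1\,\nu(dx)<\infty$ for every $t\in T$, and (L2) $\nu(A)=\nu_*(A\setminus\{0_T\})$ for every $A\in\mathcal{B}^T$. (It need not be $\sigma$-finite.) A finite-dimensional Lévy measure $\nu_I$ on $\mathbb{R}^I$, $I\in\hat T$, is a Borel measure with $\int|x|^2\wedge1\,d\nu_I<\infty$ and $\nu_I(\{0_I\})=0$. A family $\{\nu_I:I\in\hat T\}$ of finite-dimensional Lévy measures is consistent if $\nu_J\circ\pi_{IJ}^{-1}=\nu_I$ on $\mathcal{B}_0^I$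 for all $I\subset J$ in $\hat T$. A cutoff function is a bounded measurable $\chi:\mathbb{R}\to\mathbb{R}$ with $\chi(v)=1+o(|v|)$ as $v\to0$ and $\chi(v)=O(|v|^{-1})$ as $|v|\to\infty$; $\chi$ is fixed and the truncation of $y\in\mathbb{R}^S$ is $[[y]]\in\mathbb{R}^S$, $[[y]](s)=y(s)\chi(y(s))$. A process $Y=(Y_t)_{t\in T}$ is Poissonian infinitely divisible if all its finite-dimensional marginal distributions are infinitely divisible without Gaussian part. *)

theory Defs
  imports "HOL-Probability.Probability" "HOL-Library.Landau_Symbols"
begin

(* For S a set of indices, R^S is the set of extensional functions S \<rightarrow> real, so that
   restriction to S is "restrict x S" and the cylindrical sigma-algebra is that of PiM. *)

abbreviation real_space :: "'t set \<Rightarrow> ('t \<Rightarrow> real) measure" where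
  "real_space S \<equiv> Pi\<^sub>M S (\<lambda>_. borel)"

definition origin :: "'t set \<Rightarrow> 't \<Rightarrow> real" where
  "origin S = (\<lambda>s\<in>S. 0)"

definition fin_subsets :: "'t set \<Rightarrow> 't set set" where
  "fin_subsets T = {I. I \<subseteq> T \<and> finite I \<and> I \<noteq> {}}"

definition sets_off_origin :: "'t set \<Rightarrow> ('t \<Rightarrow> real) set set" where
  "sets_off_origin S = {B \<in> sets (real_space S). origin S \<notin> B}"

definition dot :: "'t set \<Rightarrow> ('t \<Rightarrow> real) \<Rightarrow> ('t \<Rightarrow> real) \<Rightarrow> real" where
  "dot I a x = (\<Sum>t\<in>I. a t * x t)"

definition inner_measure :: "'b measure \<Rightarrow> 'b set \<Rightarrow> ennreal" where
  "inner_measure \<nu> E = (SUP D \<in> {D \<in> sets \<nu>. D \<subseteq> E}. emeasure \<nu> D)"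

(* The set function \<rho>^0; it is kept as a set function because being a measure is part of
   what the equality \<nu> = \<rho>^0 asserts. *)
definition origin_removed :: "'t set \<Rightarrow> ('t \<Rightarrow> real) measure \<Rightarrow> ('t \<Rightarrow> real) set \<Rightarrow> ennreal" where
  "origin_removed T \<rho> A = inner_measure \<rho> (A - {origin T})"

definition levy_measure :: "'t set \<Rightarrow> ('t \<Rightarrow> real) measure \<Rightarrow> bool" where
  "levy_measure T \<nu> \<longleftrightarrow>
     sets \<nu> = sets (real_space T) \<and>
     (\<forall>t\<in>T. (\<integral>\<^sup>+ x. ennreal (min (\<bar>x t\<bar>\<^sup>2) 1) \<partial>\<nu>) < \<infinity>) \<and>
     (\<forall>A \<in> sets (real_space T). emeasure \<nu> A = inner_measure \<nu> (A - {origin T}))"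

definition fd_levy_measure :: "'t set \<Rightarrow> ('t \<Rightarrow> real) measure \<Rightarrow> bool" where
  "fd_levy_measure I \<nu> \<longleftrightarrow>
     sets \<nu> = sets (real_space I) \<and>
     (\<integral>\<^sup>+ x. ennreal (min (dot I x x) 1) \<partial>\<nu>) < \<infinity> \<and>
     emeasure \<nu> {origin I} = 0"

definition consistent_levy_system ::
    "'t set \<Rightarrow> ('t set \<Rightarrow> ('t \<Rightarrow> real) measure) \<Rightarrow> bool" where
  "consistent_levy_system T N \<longleftrightarrow>
     (\<forall>I \<in> fin_subsets T. fd_levy_measure I (N I)) \<and>
     (\<forall>I \<in> fin_subsets T. \<forall>J \<in> fin_subsets T. I \<subseteq> J \<longrightarrow>
        (\<forall>B \<in> sets_off_origin I.
           emeasure (distr (N J) (real_space I) (\<lambda>x. restrict x I)) B = emeasure (N I) B))"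

definition has_projections ::
    "'t set \<Rightarrow> ('t set \<Rightarrow> ('t \<Rightarrow> real) measure) \<Rightarrow> ('t \<Rightarrow> real) measure \<Rightarrow> bool" where
  "has_projections T N \<rho> \<longleftrightarrow>
     (\<forall>I \<in> fin_subsets T. \<forall>B \<in> sets_off_origin I.
        emeasure (distr \<rho> (real_space I) (\<lambda>x. restrict x I)) B = emeasure (N I) B)"

definition cutoff_function :: "(real \<Rightarrow> real) \<Rightarrow> bool" where
  "cutoff_function \<kappa> \<longleftrightarrow>
     \<kappa> \<in> borel_measurable borel \<and> bounded (range \<kappa>) \<and>
     (\<lambda>v. \<kappa> v - 1) \<in> o[at 0](\<lambda>v. \<bar>v\<bar>) \<and>
     \<kappa> \<in> O[at_infinity](\<lambda>v. inverse \<bar>v\<bar>)"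

definition truncation :: "(real \<Rightarrow> real) \<Rightarrow> 't set \<Rightarrow> ('t \<Rightarrow> real) \<Rightarrow> 't \<Rightarrow> real" where
  "truncation \<kappa> S y = (\<lambda>s\<in>S. y s * \<kappa> (y s))"

definition lk_integrand ::
    "(real \<Rightarrow> real) \<Rightarrow> 't set \<Rightarrow> ('t \<Rightarrow> real) \<Rightarrow> ('t \<Rightarrow> real) \<Rightarrow> complex" where
  "lk_integrand \<kappa> I a y =
     exp (\<i> * complex_of_real (dot I a y)) - 1
       - \<i> * complex_of_real (dot I a (truncation \<kappa> I y))"

(* \<mu> is the law of a sum of n independent vectors with law \<mu>n, i.e. the n-fold convolution
   power of \<mu>n; HOL-Probability's convolution only covers euclidean-space types. *)
definition infinitely_divisible :: "'t set \<Rightarrow> ('t \<Rightarrow> real) measure \<Rightarrow> bool" where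
  "infinitely_divisible I \<mu> \<longleftrightarrow>
     prob_space \<mu> \<and> sets \<mu> = sets (real_space I) \<and>
     (\<forall>n::nat. n \<ge> 1 \<longrightarrow>
        (\<exists>\<mu>n. prob_space \<mu>n \<and> sets \<mu>n = sets (real_space I) \<and>
           \<mu> = distr (Pi\<^sub>M {..<n} (\<lambda>_. \<mu>n)) (real_space I) (\<lambda>x. \<lambda>t\<in>I. \<Sum>k<n. x k t)))"

(* (\<Sigma>, \<nu>, b) is a Levy-Khintchine triplet of \<mu>: \<Sigma> is the covariance of the Gaussian part. *)
definition levy_khintchine_triplet ::
    "(real \<Rightarrow> real) \<Rightarrow> 't set \<Rightarrow> ('t \<Rightarrow> real) measure \<Rightarrow>
     ('t \<Rightarrow> 't \<Rightarrow> real) \<Rightarrow> ('t \<Rightarrow> real) measure \<Rightarrow> ('t \<Rightarrow> real) \<Rightarrow> bool" where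
  "levy_khintchine_triplet \<kappa> I \<mu> \<Sigma> \<nu> b \<longleftrightarrow>
     (\<forall>s\<in>I. \<forall>t\<in>I. \<Sigma> s t = \<Sigma> t s) \<and>
     (\<forall>a \<in> space (real_space I). (\<Sum>s\<in>I. \<Sum>t\<in>I. a s * \<Sigma> s t * a t) \<ge> 0) \<and>
     fd_levy_measure I \<nu> \<and> b \<in> space (real_space I) \<and>
     (\<forall>a \<in> space (real_space I).
        integrable \<nu> (lk_integrand \<kappa> I a) \<and>
        (CLINT y|\<mu>. exp (\<i> * complex_of_real (dot I a y))) =
          exp (- complex_of_real ((\<Sum>s\<in>I. \<Sum>t\<in>I. a s * \<Sigma> s t * a t) / 2)
               + (CLINT y|\<nu>. lk_integrand \<kappa> I a y)
               + \<i> * complex_of_real (dot I a b)))"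

(* The triplet of an infinitely divisible law exists and is unique given the cutoff \<kappa>; \<kappa> only
   affects b, so this notion does not depend on \<kappa>. *)
definition no_gaussian_part :: "(real \<Rightarrow> real) \<Rightarrow> 't set \<Rightarrow> ('t \<Rightarrow> real) measure \<Rightarrow> bool" where
  "no_gaussian_part \<kappa> I \<mu> \<longleftrightarrow> (\<exists>\<nu> b. levy_khintchine_triplet \<kappa> I \<mu> (\<lambda>_ _. 0) \<nu> b)"

definition poissonian_id_process ::
    "(real \<Rightarrow> real) \<Rightarrow> 't set \<Rightarrow> 'w measure \<Rightarrow> ('t \<Rightarrow> 'w \<Rightarrow> real) \<Rightarrow> bool" where
  "poissonian_id_process \<kappa> T M Y \<longleftrightarrow>
     prob_space M \<and> (\<forall>t\<in>T. Y t \<in> borel_measurable M) \<and>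
     (\<forall>I \<in> fin_subsets T.
        infinitely_divisible I (distr M (real_space I) (\<lambda>\<omega>. \<lambda>t\<in>I. Y t \<omega>)) \<and>
        no_gaussian_part \<kappa> I (distr M (real_space I) (\<lambda>\<omega>. \<lambda>t\<in>I. Y t \<omega>)))"

end

theory Submission
  imports Defs
begin

text \<open>
  Away from the origin a Levy measure is locally finite along coordinates: the weight
  \<open>min (|x\<^sub>I|\<^sup>2) 1\<close> is integrable, and it is positive exactly on the set \<open>nonzero_on I\<close> of
  functions that do not vanish identically on \<open>I\<close>. Multiplying a consistent system by this
  weight, for one fixed finite \<open>I\<close>, gives a projective family of finite measures, without any
  exceptional behaviour at the origin. Kolmogorov's theorem extends it to the whole function
  space, and dividing by the weight again gives a measure that lives on \<open>nonzero_on I\<close> and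
  projects correctly there (lemma \<open>exists_extends_on\<close>). The same weight, used with the
  uniqueness of finite measures given on cylinders, shows that these pieces are determined by the system
  (lemma \<open>extends_on_coincide_on\<close>); hence they increase with \<open>I\<close>, and their directed supremum over
  all finite \<open>I\<close> is the required Levy measure (lemma \<open>exists_levy_measure\<close>). No piece charges the
  set where \<open>x\<close> vanishes on \<open>I\<close>, so the supremum is approximated from inside by sets that avoid
  the origin: this is the second axiom of Levy measures. For uncountable index sets the singleton
  of the origin is not measurable, which is why that axiom is phrased with an inner measure.

  Uniqueness, and the comparison with an arbitrary measure \<open>\<rho>\<close> with the same projections, rest on
  the fact that a measurable set depends on countably many coordinates only. If it
  misses the origin, it is therefore covered by countably many sets \<open>nonzero_on {t}\<close>, and on each
  of them the two measures agree (lemma \<open>has_projections_coincide_on\<close>). So they have the same inner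
  measure outside the origin, and for a Levy measure this inner measure is the measure itself.

  For a Poissonian process, the marginal Levy measures form a consistent system because the Levy
  measure of a law is unique. To see this uniqueness, take second differences of the
  characteristic exponent \<open>F\<close>: by the cosine addition formula,
  \<open>2 F(a) - F(a + u) - F(a - u)\<close> is the Fourier transform of the finite measure
  \<open>(2 - 2 cos \<langle>u, x\<rangle>) \<nu>(dx)\<close>, and neither the shift nor the truncation occurs in it any more. The
  law determines only the exponential of this transform, but the transform is continuous and real
  at the origin, so its exponential determines it. A finite measure on finitely many coordinates is in turn
  determined by its Fourier transform, by one-dimensional uniqueness applied coordinate by
  coordinate (lemma \<open>finite_measure_eq_if_fourier_eq\<close>). Thus \<open>\<nu>\<close> is determined on each set
  \<open>{x. cos \<langle>u, x\<rangle> \<noteq> 1}\<close>, and countably many of these cover everything but the origin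
  (lemma \<open>lk_representation_coincide_on\<close>).
\<close>

section \<open>Measures that agree on a set\<close>

text \<open>The set \<open>U\<close> itself need not be measurable. This matters because the complement of the origin is
  not measurable in a function space over an uncountable index set.\<close>

definition coincide_on :: "'a set \<Rightarrow> 'a measure \<Rightarrow> 'a measure \<Rightarrow> bool" where
  "coincide_on U M N \<longleftrightarrow> sets M = sets N \<and> (\<forall>A\<in>sets M. A \<subseteq> U \<longrightarrow> emeasure M A = emeasure N A)"

lemma coincide_onI:
  assumes "sets M = sets N" "\<And>A. A \<in> sets M \<Longrightarrow> A \<subseteq> U \<Longrightarrow> emeasure M A = emeasure N A"
  shows "coincide_on U M N"
  using assms by (auto simp: coincide_on_def)

lemma coincide_on_sets: "coincide_on U M N \<Longrightarrow> sets M = sets N"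
  by (simp add: coincide_on_def)

lemma coincide_onD:
  "coincide_on U M N \<Longrightarrow> A \<in> sets M \<Longrightarrow> A \<subseteq> U \<Longrightarrow> emeasure M A = emeasure N A"
  by (simp add: coincide_on_def)

lemma coincide_on_trans: "coincide_on U M N \<Longrightarrow> coincide_on U N P \<Longrightarrow> coincide_on U M P"
  by (simp add: coincide_on_def)

lemma coincide_on_subset: "coincide_on V M N \<Longrightarrow> U \<inter> space M \<subseteq> V \<Longrightarrow> coincide_on U M N"
  unfolding coincide_on_def by (meson le_inf_iff order_trans sets.sets_into_space)

text \<open>Cutting a set into disjoint pieces, each inside one of the \<open>U n\<close>, reduces the claim to countable
  additivity.\<close>

lemma coincide_on_UN:
  fixes U :: "nat \<Rightarrow> 'a set"
  assumes co: "\<And>n. coincide_on (U n) M N" and meas: "\<And>n. U n \<inter> space M \<in> sets M"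
  shows "coincide_on (\<Union>n. U n) M N"
proof (rule coincide_onI)
  show s: "sets M = sets N" using co by (auto simp: coincide_on_def)
  fix A assume A: "A \<in> sets M" "A \<subseteq> (\<Union>n. U n)"
  define D where "D n = A \<inter> disjointed (\<lambda>n. U n \<inter> space M) n" for n
  have D: "D n \<in> sets M" for n
    unfolding D_def using A(1) sets.range_disjointed_sets[of "\<lambda>n. U n \<inter> space M" M] meas by blast
  have sub: "D n \<subseteq> U n" for n
    using disjointed_subset[of "\<lambda>n. U n \<inter> space M" n] by (auto simp: D_def)
  have dis: "disjoint_family D"
    unfolding D_def using disjoint_family_disjointed[of "\<lambda>n. U n \<inter> space M"]
    by (auto simp: disjoint_family_on_def)
  have un: "(\<Union>n. D n) = A"
    using A(2) sets.sets_into_space[OF A(1)] UN_disjointed_eq[of "\<lambda>n. U n \<inter> space M"]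
    unfolding D_def by blast
  have "emeasure M A = (\<Sum>n. emeasure M (D n))"
    using suminf_emeasure[of D M] D dis un by (auto simp: image_subset_iff)
  also have "\<dots> = (\<Sum>n. emeasure N (D n))"
    using coincide_onD[OF co D sub] by simp
  also have "\<dots> = emeasure N A"
    using suminf_emeasure[of D N] D dis un s by (auto simp: image_subset_iff)
  finally show "emeasure M A = emeasure N A" .
qed

lemma coincide_on_countable_UN:
  assumes "countable C" "sets M = sets N"
    and co: "\<And>c. c \<in> C \<Longrightarrow> coincide_on (U c) M N" and meas: "\<And>c. c \<in> C \<Longrightarrow> U c \<inter> space M \<in> sets M"
  shows "coincide_on (\<Union>c\<in>C. U c) M N"
proof (cases "C = {}")
  case True
  then show ?thesis using assms(2) by (auto simp: coincide_on_def)
next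
  case False
  have "coincide_on (\<Union>n. U (from_nat_into C n)) M N"
    by (intro coincide_on_UN co meas from_nat_into False)
  moreover have "(\<Union>n. U (from_nat_into C n)) = (\<Union>c\<in>C. U c)"
    using range_from_nat_into[OF False assms(1)] by (metis image_image)
  ultimately show ?thesis by simp
qed

text \<open>This turns agreement on \<open>U\<close> into an equality of measures, so that integrals of functions that
  vanish outside \<open>U\<close> can be transferred by rewriting.\<close>

lemma density_indicator_eq_if_coincide_on:
  assumes co: "coincide_on U M N" and meas: "U \<inter> space M \<in> sets M"
  shows "density M (indicator U) = density N (indicator U)"
proof -
  have sp: "space M = space N" "sets M = sets N"
    using sets_eq_imp_space_eq coincide_on_sets[OF co] by auto
  have ind: "(indicator U :: _ \<Rightarrow> ennreal) \<in> borel_measurable M" 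
    using meas by (simp add: borel_measurable_indicator_iff)
  then have indN: "(indicator U :: _ \<Rightarrow> ennreal) \<in> borel_measurable N"
    using measurable_cong_sets[OF sp(2) refl] by blast
  have *: "emeasure (density P (indicator U)) A = emeasure P (A \<inter> (U \<inter> space M))"
    if P: "sets P = sets M" and A: "A \<in> sets M" for P A
  proof -
    have P': "(indicator U :: _ \<Rightarrow> ennreal) \<in> borel_measurable P"
      using ind measurable_cong_sets[OF P refl] by blast
    have "emeasure (density P (indicator U)) A = (\<integral>\<^sup>+x. indicator U x * indicator A x \<partial>P)"
      using A P by (intro emeasure_density P') auto
    also have "\<dots> = (\<integral>\<^sup>+x. indicator (A \<inter> (U \<inter> space M)) x \<partial>P)"
      using sets_eq_imp_space_eq[OF P] by (intro nn_integral_cong) (auto split: split_indicator)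
    also have "\<dots> = emeasure P (A \<inter> (U \<inter> space M))"
      using A meas P by (intro nn_integral_indicator) auto
    finally show ?thesis .
  qed
  show ?thesis
  proof (rule measure_eqI)
    fix A assume "A \<in> sets (density M (indicator U))"
    then have A: "A \<in> sets M" by simp
    have "emeasure M (A \<inter> (U \<inter> space M)) = emeasure N (A \<inter> (U \<inter> space M))"
      using A meas by (intro coincide_onD[OF co]) auto
    then show "emeasure (density M (indicator U)) A = emeasure (density N (indicator U)) A"
      using *[of M A] *[of N A] A sp by simp
  qed (simp add: sp)
qed

lemma nn_integral_coincide_on:
  assumes co: "coincide_on U M N" and meas: "U \<inter> space M \<in> sets M"
    and f[measurable]: "f \<in> borel_measurable M" and z: "\<And>x. x \<in> space M \<Longrightarrow> x \<notin> U \<Longrightarrow> f x = (0::ennreal)"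
  shows "(\<integral>\<^sup>+x. f x \<partial>M) = (\<integral>\<^sup>+x. f x \<partial>N)"
proof -
  have sp: "space M = space N" "sets M = sets N"
    using sets_eq_imp_space_eq coincide_on_sets[OF co] by auto
  have ind: "(indicator U :: _ \<Rightarrow> ennreal) \<in> borel_measurable M" 
    using meas by (simp add: borel_measurable_indicator_iff)
  then have indN: "(indicator U :: _ \<Rightarrow> ennreal) \<in> borel_measurable N"
    and fN: "f \<in> borel_measurable N"
    using f measurable_cong_sets[OF sp(2) refl] by blast+
  have "(\<integral>\<^sup>+x. f x \<partial>M) = (\<integral>\<^sup>+x. indicator U x * f x \<partial>M)"
    by (rule nn_integral_cong) (auto simp: z split: split_indicator)
  also have "\<dots> = (\<integral>\<^sup>+x. f x \<partial>density M (indicator U))"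
    using ind by (simp add: nn_integral_density)
  also have "\<dots> = (\<integral>\<^sup>+x. f x \<partial>density N (indicator U))"
    using density_indicator_eq_if_coincide_on[OF co meas] by simp
  also have "\<dots> = (\<integral>\<^sup>+x. indicator U x * f x \<partial>N)"
    using indN fN by (simp add: nn_integral_density)
  also have "\<dots> = (\<integral>\<^sup>+x. f x \<partial>N)"
    by (rule nn_integral_cong) (auto simp: z sp split: split_indicator)
  finally show ?thesis .
qed

lemma integral_coincide_on:
  fixes f :: "'a \<Rightarrow> complex"
  assumes co: "coincide_on U M N" and meas: "U \<inter> space M \<in> sets M"
    and f[measurable]: "f \<in> borel_measurable M" and z: "\<And>x. x \<in> space M \<Longrightarrow> x \<notin> U \<Longrightarrow> f x = 0"
  shows "integrable M f \<longleftrightarrow> integrable N f" (is ?int)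
    and "(CLINT x|M. f x) = (CLINT x|N. f x)" (is ?eq)
proof -
  have sp: "space M = space N" "sets M = sets N"
    using sets_eq_imp_space_eq coincide_on_sets[OF co] by auto
  define u :: "_ \<Rightarrow> real" where "u = indicator U"
  have ind: "u \<in> borel_measurable M" 
    using meas by (simp add: borel_measurable_indicator_iff u_def)
  then have indN: "u \<in> borel_measurable N"
    and fN: "f \<in> borel_measurable N"
    using f measurable_cong_sets[OF sp(2) refl] by blast+
  have u: "(indicator U :: _ \<Rightarrow> ennreal) = (\<lambda>x. ennreal (u x))"
    by (auto simp: u_def split: split_indicator)
  have eq: "density M (\<lambda>x. ennreal (u x)) = density N (\<lambda>x. ennreal (u x))"
    using density_indicator_eq_if_coincide_on[OF co meas] by (simp add: u)
  have uf: "u x *\<^sub>R f x = f x" if "x \<in> space M" for x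
    using z[OF that] by (auto simp: u_def split: split_indicator)
  have "integrable M f \<longleftrightarrow> integrable M (\<lambda>x. u x *\<^sub>R f x)"
    by (rule Bochner_Integration.integrable_cong) (simp_all add: uf)
  also have "\<dots> \<longleftrightarrow> integrable N (\<lambda>x. u x *\<^sub>R f x)"
    using integrable_density[of f M u] integrable_density[of f N u] ind indN f fN eq
    by (simp add: u_def)
  also have "\<dots> \<longleftrightarrow> integrable N f"
    by (rule Bochner_Integration.integrable_cong) (simp_all add: uf sp[symmetric])
  finally show ?int .
  have "(CLINT x|M. f x) = (CLINT x|M. u x *\<^sub>R f x)"
    by (rule Bochner_Integration.integral_cong) (simp_all add: uf)
  also have "\<dots> = (CLINT x|N. u x *\<^sub>R f x)"
    using integral_density[of f M u] integral_density[of f N u] ind indN f fN eq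
    by (simp add: u_def)
  also have "\<dots> = (CLINT x|N. f x)"
    by (rule Bochner_Integration.integral_cong) (simp_all add: uf sp[symmetric])
  finally show ?eq .
qed

text \<open>A density that is positive on \<open>A\<close> can be undone there. Both the existence and the uniqueness of
  infinite measures are reduced to finite ones in this way.\<close>

lemma emeasure_density_inverse:
  fixes g :: "'a \<Rightarrow> real"
  assumes g[measurable]: "g \<in> borel_measurable M" and A[measurable]: "A \<in> sets M"
    and pos: "\<And>x. x \<in> A \<Longrightarrow> g x > 0"
  shows "(\<integral>\<^sup>+x. ennreal (inverse (g x)) * indicator A x \<partial>density M (\<lambda>x. ennreal (g x))) = emeasure M A"
proof -
  have "(\<integral>\<^sup>+x. ennreal (inverse (g x)) * indicator A x \<partial>density M (\<lambda>x. ennreal (g x)))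
      = (\<integral>\<^sup>+x. ennreal (g x) * (ennreal (inverse (g x)) * indicator A x) \<partial>M)"
    by (subst nn_integral_density) simp_all
  also have "\<dots> = (\<integral>\<^sup>+x. indicator A x \<partial>M)"
  proof (rule nn_integral_cong)
    fix x
    show "ennreal (g x) * (ennreal (inverse (g x)) * indicator A x) = indicator A x"
      using pos[of x] by (cases "x \<in> A") (simp_all add: ennreal_mult[symmetric])
  qed
  also have "\<dots> = emeasure M A" by simp
  finally show ?thesis .
qed

lemma coincide_on_if_density_eq:
  fixes g :: "'a \<Rightarrow> real"
  assumes s: "sets M = sets N" and g: "g \<in> borel_measurable M"
    and eq: "density M (\<lambda>x. ennreal (g x)) = density N (\<lambda>x. ennreal (g x))"
  shows "coincide_on {x. g x > 0} M N"
proof (rule coincide_onI[OF s])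
  fix A assume A: "A \<in> sets M" "A \<subseteq> {x. g x > 0}"
  have gN: "g \<in> borel_measurable N" using g measurable_cong_sets[OF s refl] by blast
  show "emeasure M A = emeasure N A"
    using emeasure_density_inverse[OF g A(1)] emeasure_density_inverse[OF gN, of A] A s eq by auto
qed

section \<open>Cylinders away from the origin\<close>

lemma fin_subsetsD: "I \<in> fin_subsets T \<Longrightarrow> I \<subseteq> T \<and> finite I \<and> I \<noteq> {}"
  by (simp add: fin_subsets_def)

lemma fin_subsets_Un: "I \<in> fin_subsets T \<Longrightarrow> J \<in> fin_subsets T \<Longrightarrow> I \<union> J \<in> fin_subsets T"
  by (auto simp: fin_subsets_def)

text \<open>In \<open>\<real>\<^sup>I\<close> this is the complement of the origin; in a larger product it is the cylinder over that
  complement. Carrying no reference to the ambient index set, it is preserved by all restriction maps.\<close>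

definition nonzero_on :: "'t set \<Rightarrow> ('t \<Rightarrow> real) set" where
  "nonzero_on I = {x. \<exists>i\<in>I. x i \<noteq> 0}"

lemma nonzero_on_measurable:
  assumes "I \<subseteq> S" "countable I"
  shows "nonzero_on I \<inter> space (real_space S) \<in> sets (real_space S)"
proof -
  have "nonzero_on I \<inter> space (real_space S) = (\<Union>i\<in>I. {x \<in> space (real_space S). x i \<noteq> 0})"
    by (auto simp: nonzero_on_def)
  also have "\<dots> \<in> sets (real_space S)"
  proof (intro sets.countable_UN'' assms(2))
    fix i assume "i \<in> I"
    then have [measurable]: "(\<lambda>x. x i) \<in> borel_measurable (real_space S)"
      using assms(1) by (auto intro: measurable_component_singleton)
    show "{x \<in> space (real_space S). x i \<noteq> 0} \<in> sets (real_space S)" by measurable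
  qed
  finally show ?thesis .
qed

lemma nonzero_on_iff_not_origin:
  "x \<in> space (real_space I) \<Longrightarrow> x \<in> nonzero_on I \<longleftrightarrow> x \<noteq> origin I"
  by (auto simp: nonzero_on_def origin_def space_PiM PiE_iff extensional_def fun_eq_iff)

lemma nonzero_on_restrict: "I \<subseteq> K \<Longrightarrow> restrict x K \<in> nonzero_on I \<longleftrightarrow> x \<in> nonzero_on I"
  by (auto simp: nonzero_on_def)

lemma nonzero_on_mono: "I \<subseteq> J \<Longrightarrow> nonzero_on I \<subseteq> nonzero_on J"
  by (auto simp: nonzero_on_def)

lemma sets_off_origin_iff:
  "B \<in> sets_off_origin I \<longleftrightarrow> B \<in> sets (real_space I) \<and> B \<subseteq> nonzero_on I"
proof -
  have "origin I \<notin> nonzero_on I" by (simp add: nonzero_on_def origin_def)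
  then show ?thesis
    unfolding sets_off_origin_def using nonzero_on_iff_not_origin sets.sets_into_space by blast
qed

text \<open>The integrand of the finite-dimensional Levy condition, regarded as a function on every product
  that contains the coordinates \<open>I\<close>. It serves as a positive integrable density on \<open>nonzero_on I\<close>.\<close>

definition weight :: "'t set \<Rightarrow> ('t \<Rightarrow> real) \<Rightarrow> real" where
  "weight I x = min (dot I x x) 1"

lemma weight_measurable: 
  assumes "I \<subseteq> S"
  shows "weight I \<in> borel_measurable (real_space S)"
proof -
  have [measurable]: "(\<lambda>x. x i) \<in> borel_measurable (real_space S)" if "i \<in> I" for i
    using assms that by (auto intro: measurable_component_singleton)
  show ?thesis unfolding weight_def dot_def by measurable
qed

lemma dot_self_nonneg: "0 \<le> dot I x x"
  by (auto simp: dot_def intro: sum_nonneg)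

lemma weight_nonneg: "0 \<le> weight I x"
  by (simp add: weight_def dot_self_nonneg)

lemma weight_pos_iff: "finite I \<Longrightarrow> weight I x > 0 \<longleftrightarrow> x \<in> nonzero_on I"
proof -
  assume I: "finite I"
  have "dot I x x = 0 \<longleftrightarrow> x \<notin> nonzero_on I"
    using I by (simp add: dot_def nonzero_on_def sum_nonneg_eq_0_iff)
  moreover have "weight I x > 0 \<longleftrightarrow> dot I x x \<noteq> 0"
    using dot_self_nonneg[of I x] by (auto simp: weight_def)
  ultimately show ?thesis by simp
qed

lemma weight_eq_0: "finite I \<Longrightarrow> x \<notin> nonzero_on I \<Longrightarrow> weight I x = 0"
  using weight_pos_iff[of I x] weight_nonneg[of I x] by simp

lemma weight_restrict: "I \<subseteq> K \<Longrightarrow> weight I (restrict x K) = weight I x"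
  unfolding weight_def dot_def by (subst sum.cong[OF refl]) auto

lemma weight_mono: "I \<subseteq> J \<Longrightarrow> finite J \<Longrightarrow> weight I x \<le> weight J x"
  unfolding weight_def dot_def by (intro min.mono sum_mono2) auto

lemma consistent_levy_system_coincide_on:
  assumes "consistent_levy_system T N" "I \<in> fin_subsets T" "J \<in> fin_subsets T" "I \<subseteq> J"
  shows "coincide_on (nonzero_on I) (distr (N J) (real_space I) (\<lambda>x. restrict x I)) (N I)"
  using assms unfolding consistent_levy_system_def
  by (intro coincide_onI) (auto simp: sets_off_origin_iff fd_levy_measure_def)

section \<open>Extending a consistent system from one finite set of coordinates\<close>

text \<open>Having the right finite-dimensional projections on the cylinder \<open>nonzero_on I\<close> only. Restricting
  to \<open>K \<supseteq> I\<close> is what makes the cylinder visible in \<open>\<real>\<^sup>K\<close>.\<close>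

definition extends_on ::
    "'t set \<Rightarrow> ('t set \<Rightarrow> ('t \<Rightarrow> real) measure) \<Rightarrow> 't set \<Rightarrow> ('t \<Rightarrow> real) measure \<Rightarrow> bool" where
  "extends_on T N I \<rho> \<longleftrightarrow> sets \<rho> = sets (real_space T) \<and>
     (\<forall>K\<in>fin_subsets T. I \<subseteq> K \<longrightarrow>
        coincide_on (nonzero_on I) (distr \<rho> (real_space K) (\<lambda>x. restrict x K)) (N K))"

lemma restrict_measurable:
  "sets \<rho> = sets (real_space T) \<Longrightarrow> K \<subseteq> T \<Longrightarrow> (\<lambda>x. restrict x K) \<in> measurable \<rho> (real_space K)"
  using measurable_restrict_subset[of K T "\<lambda>_. borel"] measurable_cong_sets by blast

lemma distr_restrict_restrict:
  assumes "sets \<rho> = sets (real_space T)" "I \<subseteq> J" "J \<subseteq> T"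
  shows "distr (distr \<rho> (real_space J) (\<lambda>x. restrict x J)) (real_space I) (\<lambda>x. restrict x I)
    = distr \<rho> (real_space I) (\<lambda>x. restrict x I)"
proof -
  have *: "(\<lambda>x. restrict x I) \<circ> (\<lambda>x. restrict x J) = (\<lambda>x :: 'a \<Rightarrow> real. restrict x I)"
    using assms(2) by (auto simp: restrict_def fun_eq_iff)
  show ?thesis
    using assms by (subst distr_distr) (auto intro: restrict_measurable simp: *)
qed

text \<open>The preimage under restriction to \<open>K \<supseteq> I\<close> of a subset of \<open>nonzero_on I\<close> again lies in
  \<open>nonzero_on I \<subseteq> nonzero_on J\<close>.\<close>

lemma distr_coincide_on:
  assumes co: "coincide_on (nonzero_on J) M M'" and s: "sets M = sets (real_space T)"
    and "I \<subseteq> J" "J \<subseteq> T" "I \<subseteq> K" "K \<subseteq> T"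
  shows "coincide_on (nonzero_on I) (distr M (real_space K) (\<lambda>x. restrict x K))
           (distr M' (real_space K) (\<lambda>x. restrict x K))"
proof (rule coincide_onI)
  fix A assume A: "A \<in> sets (distr M (real_space K) (\<lambda>x. restrict x K))" "A \<subseteq> nonzero_on I"
  have s': "sets M' = sets (real_space T)" using coincide_on_sets[OF co] s by simp
  note m = restrict_measurable[OF s \<open>K \<subseteq> T\<close>] restrict_measurable[OF s' \<open>K \<subseteq> T\<close>]
  have sp: "space M = space M'" using sets_eq_imp_space_eq coincide_on_sets[OF co] by auto
  have "emeasure M ((\<lambda>x. restrict x K) -` A \<inter> space M) = emeasure M' ((\<lambda>x. restrict x K) -` A \<inter> space M)"
  proof (rule coincide_onD[OF co])
    show "(\<lambda>x. restrict x K) -` A \<inter> space M \<subseteq> nonzero_on J"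
      using A(2) nonzero_on_restrict[OF \<open>I \<subseteq> K\<close>] nonzero_on_mono[OF \<open>I \<subseteq> J\<close>] by fastforce
  qed (use A m in auto)
  then show "emeasure (distr M (real_space K) (\<lambda>x. restrict x K)) A = 
      emeasure (distr M' (real_space K) (\<lambda>x. restrict x K)) A"
    using A m by (simp add: emeasure_distr sp)
qed simp

text \<open>For finite \<open>K \<supseteq> I\<close> the set \<open>J\<close> need not be contained in \<open>K\<close>; the hypothesis on \<open>J\<close> applies to
  \<open>K \<union> J\<close>, from which consistency leads down to \<open>K\<close>.\<close>

lemma extends_on_mono:
  assumes cons: "consistent_levy_system T N" and J: "J \<in> fin_subsets T" and I: "I \<subseteq> J" 
    and ext: "extends_on T N J \<rho>"
  shows "extends_on T N I \<rho>"
  unfolding extends_on_def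
proof (intro conjI ballI impI)
  show s: "sets \<rho> = sets (real_space T)" using ext by (simp add: extends_on_def)
  fix K assume K: "K \<in> fin_subsets T" "I \<subseteq> K"
  define L where "L = K \<union> J"
  have L: "L \<in> fin_subsets T" "K \<subseteq> L" "J \<subseteq> L" "L \<subseteq> T" "K \<subseteq> T"
    using fin_subsets_Un[OF K(1) J] fin_subsetsD K J by (auto simp: L_def)
  have "coincide_on (nonzero_on J) (distr \<rho> (real_space L) (\<lambda>x. restrict x L)) (N L)"
    using ext L by (auto simp: extends_on_def)
  from distr_coincide_on[OF this _ I L(3) K(2) L(2)]
  have "coincide_on (nonzero_on I) (distr \<rho> (real_space K) (\<lambda>x. restrict x K))
     (distr (N L) (real_space K) (\<lambda>x. restrict x K))"
    using distr_restrict_restrict[OF s L(2,4)] by simp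
  moreover have "coincide_on (nonzero_on I) (distr (N L) (real_space K) (\<lambda>x. restrict x K)) (N K)"
    using consistent_levy_system_coincide_on[OF cons K(1) L(1,2)] nonzero_on_mono[OF K(2)] by (auto intro: coincide_on_subset)
  ultimately show "coincide_on (nonzero_on I) (distr \<rho> (real_space K) (\<lambda>x. restrict x K)) (N K)"
    by (rule coincide_on_trans)
qed

text \<open>The weight vanishes off \<open>nonzero_on I\<close>, so after multiplication by it the projections are right
  everywhere, including at the origin. This is the reason for introducing it.\<close>

lemma distr_density_weight:
  assumes ext: "extends_on T N I \<rho>" and K: "K \<in> fin_subsets T" and I: "I \<subseteq> K"
  shows "distr (density \<rho> (\<lambda>x. ennreal (weight I x))) (real_space K) (\<lambda>x. restrict x K)
    = density (N K) (\<lambda>x. ennreal (weight I x))"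
proof (rule measure_eqI)
  define D where "D = distr \<rho> (real_space K) (\<lambda>x. restrict x K)"
  have s: "sets \<rho> = sets (real_space T)" and co: "coincide_on (nonzero_on I) D (N K)"
    using ext K I by (auto simp: extends_on_def D_def)
  have sN: "sets (N K) = sets (real_space K)" using coincide_on_sets[OF co] by (simp add: D_def)
  have KT: "K \<subseteq> T" "finite I" using fin_subsetsD[OF K] I finite_subset by auto
  show "sets (distr (density \<rho> (\<lambda>x. ennreal (weight I x))) (real_space K) (\<lambda>x. restrict x K)) =
    sets (density (N K) (\<lambda>x. ennreal (weight I x)))" using sN by simp
  fix B assume "B \<in> sets (distr (density \<rho> (\<lambda>x. ennreal (weight I x))) (real_space K) (\<lambda>x. restrict x K))"
  then have B: "B \<in> sets (real_space K)" by simp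
  have [measurable]: "(\<lambda>x. restrict x K) \<in> measurable \<rho> (real_space K)" "weight I \<in> borel_measurable \<rho>"
    using restrict_measurable[OF s KT(1)] weight_measurable[of I T] KT I
    unfolding measurable_cong_sets[OF s refl] by auto
  have wK[measurable]: "weight I \<in> borel_measurable (real_space K)" by (rule weight_measurable[OF I])
  have wN: "weight I \<in> borel_measurable (N K)" unfolding measurable_cong_sets[OF sN refl] by (rule wK)
  have "emeasure (distr (density \<rho> (\<lambda>x. ennreal (weight I x))) (real_space K) (\<lambda>x. restrict x K)) B
     = (\<integral>\<^sup>+x. ennreal (weight I x) * indicator ((\<lambda>x. restrict x K) -` B \<inter> space \<rho>) x \<partial>\<rho>)"
    using B by (simp add: emeasure_distr emeasure_density)
  also have "\<dots> = (\<integral>\<^sup>+x. (\<lambda>y. ennreal (weight I y) * indicator B y) (restrict x K) \<partial>\<rho>)"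
    by (rule nn_integral_cong) (auto simp: weight_restrict[OF I] split: split_indicator)
  also have "\<dots> = (\<integral>\<^sup>+y. ennreal (weight I y) * indicator B y \<partial>D)"
    using B unfolding D_def by (subst nn_integral_distr) simp_all
  also have "\<dots> = (\<integral>\<^sup>+y. ennreal (weight I y) * indicator B y \<partial>N K)"
  proof (rule nn_integral_coincide_on[OF co])
    show "nonzero_on I \<inter> space D \<in> sets D"
      using nonzero_on_measurable[OF I countable_finite[OF KT(2)]] by (simp add: D_def)
    show "(\<lambda>x. ennreal (weight I x) * indicator B x) \<in> borel_measurable D"
      using B unfolding D_def measurable_distr_eq1 by measurable
    show "ennreal (weight I x) * indicator B x = 0" if "x \<notin> nonzero_on I" for x
      using that weight_pos_iff[OF KT(2), of x] by (simp add: not_less ennreal_neg)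
  qed
  also have "\<dots> = emeasure (density (N K) (\<lambda>x. ennreal (weight I x))) B"
    using B sN wN by (simp add: emeasure_density)
  finally show "emeasure (distr (density \<rho> (\<lambda>x. ennreal (weight I x))) (real_space K) (\<lambda>x. restrict x K)) B
     = emeasure (density (N K) (\<lambda>x. ennreal (weight I x))) B" .
qed

lemma finite_density_weight:
  assumes N: "fd_levy_measure J \<nu>" and "I \<subseteq> J" "finite J"
  shows "finite_measure (density \<nu> (\<lambda>x. ennreal (weight I x)))"
proof -
  have s: "sets \<nu> = sets (real_space J)" using N by (simp add: fd_levy_measure_def)
  have m: "weight I \<in> borel_measurable \<nu>"
    unfolding measurable_cong_sets[OF s refl] by (rule weight_measurable) fact
  have "emeasure (density \<nu> (\<lambda>x. ennreal (weight I x))) (space \<nu>) = (\<integral>\<^sup>+x. ennreal (weight I x) \<partial>\<nu>)"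
    using m by (subst emeasure_density) (auto intro!: nn_integral_cong)
  also have "\<dots> \<le> (\<integral>\<^sup>+x. ennreal (weight J x) \<partial>\<nu>)"
    by (intro nn_integral_mono ennreal_leI weight_mono assms)
  also have "\<dots> < \<infinity>" using N by (simp add: fd_levy_measure_def weight_def)
  finally show ?thesis by (intro finite_measureI) auto
qed

text \<open>After multiplication by the weight both measures are finite and agree on all cylinders, which form
  an intersection-stable generator; then the weight can be divided out on \<open>nonzero_on I\<close>.\<close>

lemma extends_on_coincide_on:
  assumes cons: "consistent_levy_system T N" and I: "I \<in> fin_subsets T"
    and ext: "extends_on T N I \<rho>" "extends_on T N I \<sigma>"
  shows "coincide_on (nonzero_on I) \<rho> \<sigma>"
proof -
  have s: "sets \<rho> = sets (real_space T)" "sets \<sigma> = sets (real_space T)"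
    using ext by (auto simp: extends_on_def)
  have sp: "space \<rho> = space (real_space T)" "space \<sigma> = space (real_space T)"
    using s[THEN sets_eq_imp_space_eq] .
  have IT: "I \<subseteq> T" "finite I" using fin_subsetsD[OF I] by auto
  define w where "w x = ennreal (weight I x)" for x
  have fd: "fd_levy_measure J (N J)" if "J \<in> fin_subsets T" for J
    using cons that by (simp add: consistent_levy_system_def)
  have "density \<rho> w = density \<sigma> w"
  proof (rule measure_eqI_PiM_infinite[where I = T and M = "\<lambda>_. borel"])
    show "finite_measure (density \<rho> w)"
    proof -
      have "emeasure (density \<rho> w) (space \<rho>) = emeasure (density (N I) w) (space (N I))"
      proof -
        have "sets (N I) = sets (real_space I)" using fd[OF I] by (simp add: fd_levy_measure_def)
        then have sI: "space (N I) = space (real_space I)" by (rule sets_eq_imp_space_eq)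
        have "(\<lambda>x. restrict x I) -` space (real_space I) \<inter> space \<rho> = space \<rho>"
          by (auto simp: space_PiM)
        then show ?thesis
          using distr_density_weight[OF ext(1) I order_refl]
            emeasure_distr[OF restrict_measurable[of "density \<rho> w" T I], of "space (real_space I)"] IT s
          unfolding w_def by (simp add: sI)
      qed
      also have "\<dots> < \<infinity>" 
        using finite_measure.emeasure_finite[OF finite_density_weight[OF fd[OF I] order_refl IT(2)]]
        unfolding w_def by (simp add: less_top)
      finally show ?thesis by (intro finite_measureI) auto
    qed
    fix A :: "'a \<Rightarrow> real set" and J assume J: "finite J" "J \<subseteq> T" and A: "\<And>i. i \<in> J \<Longrightarrow> A i \<in> sets borel"
    \<comment> \<open>A rectangle over \<open>J\<close> is a cylinder over \<open>J \<union> I\<close>, and \<open>extends_on\<close> speaks only about supersets of \<open>I\<close>.\<close>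
    define K where "K = J \<union> I"
    have K: "K \<in> fin_subsets T" "I \<subseteq> K" "K \<subseteq> T" using J I by (auto simp: K_def fin_subsets_def)
    define B where "B = prod_emb K (\<lambda>_. borel) J (Pi\<^sub>E J A)"
    have B: "B \<in> sets (real_space K)" unfolding B_def using A J by (auto simp: K_def intro: sets_PiM_I_finite)
    have e: "prod_emb T (\<lambda>_. borel) J (Pi\<^sub>E J A) = (\<lambda>x. restrict x K) -` B \<inter> space (real_space T)"
      using K by (auto simp: B_def prod_emb_def space_PiM K_def restrict_def PiE_iff extensional_def)
    have "emeasure (density \<tau> w) (prod_emb T (\<lambda>_. borel) J (Pi\<^sub>E J A)) = emeasure (density (N K) w) B"
      if "extends_on T N I \<tau>" "sets \<tau> = sets (real_space T)" for \<tau>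
      unfolding w_def distr_density_weight[OF that(1) K(1,2), symmetric] e
      using B K that by (subst emeasure_distr) (auto intro: restrict_measurable simp: sets_eq_imp_space_eq[OF that(2)])
    from this[OF ext(1) s(1)] this[OF ext(2) s(2)]
    show "emeasure (density \<rho> w) (prod_emb T (\<lambda>_. borel) J (Pi\<^sub>E J A)) =
      emeasure (density \<sigma> w) (prod_emb T (\<lambda>_. borel) J (Pi\<^sub>E J A))" by simp
  qed (simp_all add: s)
  then have "coincide_on {x. weight I x > 0} \<rho> \<sigma>"
    using s weight_measurable[OF IT(1)] unfolding w_def
    by (intro coincide_on_if_density_eq) (auto simp: measurable_cong_sets[OF s(1) refl])
  then show ?thesis by (simp add: weight_pos_iff[OF IT(2)])
qed

text \<open>Kolmogorov's theorem for probability measures carries over to finite measures by rescaling, since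
  all members of a projective family have the same total mass, namely that of the member over the
  empty index set. Mass zero cannot be normalised and is treated apart.\<close>

lemma kolmogorov_extension_finite:
  fixes Q :: "'t set \<Rightarrow> ('t \<Rightarrow> real) measure"
  assumes fin: "\<And>J. finite J \<Longrightarrow> J \<subseteq> T \<Longrightarrow> finite_measure (Q J)"
    and proj: "\<And>J H. J \<subseteq> H \<Longrightarrow> finite H \<Longrightarrow> H \<subseteq> T \<Longrightarrow>
       Q J = distr (Q H) (real_space J) (\<lambda>x. restrict x J)"
  shows "\<exists>R. sets R = sets (real_space T) \<and>
    (\<forall>J. finite J \<longrightarrow> J \<subseteq> T \<longrightarrow> distr R (real_space J) (\<lambda>x. restrict x J) = Q J)"
proof -
  have sQ: "sets (Q J) = sets (real_space J)" if "finite J" "J \<subseteq> T" for J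
    using that by (subst proj[of J J]) auto
  have spQ: "space (Q J) = space (real_space J)" if "finite J" "J \<subseteq> T" for J
    using sQ[OF that] by (rule sets_eq_imp_space_eq)
  define c where "c = emeasure (Q {}) (space (Q {}))"
  have mass: "emeasure (Q J) (space (Q J)) = c" if J: "finite J" "J \<subseteq> T" for J
  proof -
    have "c = emeasure (distr (Q J) (real_space {}) (\<lambda>x. restrict x {})) (space (real_space {}))"
      using J spQ[of "{}"] by (subst proj[of "{}" J, symmetric]) (auto simp: c_def)
    also have "\<dots> = emeasure (Q J) ((\<lambda>x. restrict x {}) -` space (real_space {}) \<inter> space (Q J))"
      using J by (intro emeasure_distr restrict_measurable[OF sQ]) auto
    also have "(\<lambda>x. restrict x {}) -` space (real_space {}) \<inter> space (Q J) = space (Q J)"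
      by (auto simp: space_PiM)
    finally show ?thesis by simp
  qed
  have c_fin: "c \<noteq> \<infinity>" unfolding c_def using finite_measure.emeasure_finite[OF fin[of "{}"]] by simp
  show ?thesis
  proof (cases "c = 0")
    case True
    show ?thesis
    proof (intro exI[of _ "null_measure (real_space T)"] conjI allI impI)
      fix J assume J: "finite J" "J \<subseteq> T"
      show "distr (null_measure (real_space T)) (real_space J) (\<lambda>x. restrict x J) = Q J"
      proof (rule measure_eqI)
        fix A assume "A \<in> sets (distr (null_measure (real_space T)) (real_space J) (\<lambda>x. restrict x J))"
        then have A: "A \<in> sets (real_space J)" by simp
        have "emeasure (Q J) A \<le> emeasure (Q J) (space (Q J))" by (rule emeasure_space)
        then have "emeasure (Q J) A = 0" using mass[OF J] True by simp
        then show "emeasure (distr (null_measure (real_space T)) (real_space J) (\<lambda>x. restrict x J)) A = emeasure (Q J) A"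
          using A J restrict_measurable[of "null_measure (real_space T)" T J]
          by (simp add: emeasure_distr)
      qed (simp add: sQ[OF J])
    qed simp
  next
    case False
    define P where "P J = scale_measure (inverse c) (Q J)" for J
    interpret polish_projective T P
    proof (intro polish_projective.intro projective_family.intro)
      fix J H :: "'t set" assume JH: "J \<subseteq> H" "finite H" "H \<subseteq> T"
      have J: "finite J" "J \<subseteq> T" using JH finite_subset by auto
      show "P J = distr (P H) (real_space J) (\<lambda>f. restrict f J)"
      proof (rule measure_eqI)
        fix A assume "A \<in> sets (P J)"
        then have A: "A \<in> sets (real_space J)" using sQ[OF J] by (simp add: P_def)
        have m: "(\<lambda>x. restrict x J) \<in> measurable (Q H) (real_space J)" "(\<lambda>x. restrict x J) \<in> measurable (P H) (real_space J)"
          by (rule restrict_measurable[OF _ JH(1)], simp add: P_def sQ[OF JH(2,3)])+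
        show "emeasure (P J) A = emeasure (distr (P H) (real_space J) (\<lambda>f. restrict f J)) A"
          unfolding emeasure_distr[OF m(2) A] unfolding P_def emeasure_scale_measure space_scale_measure
          by (subst proj[OF JH]) (simp add: emeasure_distr[OF m(1) A])
      qed (simp add: P_def sQ[OF J])
    next
      fix J :: "'t set" assume J: "finite J" "J \<subseteq> T"
      show "prob_space (P J)"
        using mass[OF J] False c_fin ennreal_divide_self[of c]
        by (intro prob_spaceI)
           (simp add: P_def space_scale_measure mult.commute[of "inverse c"] divide_ennreal_def less_top)
    qed
    show ?thesis
    proof (intro exI[of _ "scale_measure c lim"] conjI allI impI)
      fix J assume J: "finite J" "J \<subseteq> T"
      show "distr (scale_measure c lim) (real_space J) (\<lambda>x. restrict x J) = Q J"
      proof (rule measure_eqI)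
        fix A assume "A \<in> sets (distr (scale_measure c lim) (real_space J) (\<lambda>x. restrict x J))"
        then have A: "A \<in> sets (real_space J)" by simp
        have "emeasure (distr (scale_measure c lim) (real_space J) (\<lambda>x. restrict x J)) A
          = c * emeasure lim ((\<lambda>x. restrict x J) -` A \<inter> space (real_space T))"
          using A J restrict_measurable[of "scale_measure c lim" T J]
          by (simp add: emeasure_distr space_scale_measure)
        also have "(\<lambda>x. restrict x J) -` A \<inter> space (real_space T) = emb T J A"
          by (simp add: prod_emb_def space_PiM)
        also have "emeasure lim (emb T J A) = inverse c * emeasure (Q J) A"
          using emeasure_lim_emb[OF J(2,1) A] by (simp add: P_def)
        also have "c * (inverse c * emeasure (Q J) A) = emeasure (Q J) A"
          using False c_fin ennreal_divide_self[of c] by (simp add: mult.assoc[symmetric] divide_ennreal_def less_top)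
        finally show "emeasure (distr (scale_measure c lim) (real_space J) (\<lambda>x. restrict x J)) A = emeasure (Q J) A" .
      qed (simp add: sQ[OF J])
    qed simp
  qed
qed

text \<open>Extend the weighted system and divide by the weight. The real inverse of zero is zero, so the
  division automatically removes everything outside \<open>nonzero_on I\<close>.\<close>

lemma exists_extends_on:
  assumes cons: "consistent_levy_system T N" and I: "I \<in> fin_subsets T"
  shows "\<exists>V. extends_on T N I V \<and> (\<forall>A\<in>sets V. emeasure V A = emeasure V (A \<inter> nonzero_on I))"
proof -
  have IT: "I \<subseteq> T" "finite I" using fin_subsetsD[OF I] by auto
  have fd: "fd_levy_measure J (N J)" if "J \<in> fin_subsets T" for J
    using cons that by (simp add: consistent_levy_system_def)
  define w where "w x = ennreal (weight I x)" for x
  \<comment> \<open>Over \<open>J \<union> I\<close> the weight is a function of the coordinates; \<open>J\<close> itself may miss some of \<open>I\<close>.\<close>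
  define Q where "Q J = distr (density (N (J \<union> I)) w) (real_space J) (\<lambda>x. restrict x J)" for J
  have sN: "sets (N J) = sets (real_space J)" if "J \<in> fin_subsets T" for J
    using fd[OF that] by (simp add: fd_levy_measure_def)
  have JI: "J \<union> I \<in> fin_subsets T" if "finite J" "J \<subseteq> T" for J
    using that I by (auto simp: fin_subsets_def)
  have cw: "distr (density (N H) w) (real_space K) (\<lambda>x. restrict x K) = density (N K) w"
    if "H \<in> fin_subsets T" "K \<in> fin_subsets T" "I \<subseteq> K" "K \<subseteq> H" for H K
    unfolding w_def
  proof (rule distr_density_weight[where T = H])
    show "extends_on H N I (N H)"
      unfolding extends_on_def
    proof (intro conjI ballI impI sN that)
      fix L assume L: "L \<in> fin_subsets H" "I \<subseteq> L"
      then have "L \<in> fin_subsets T" "L \<subseteq> H" using that by (auto simp: fin_subsets_def)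
      from consistent_levy_system_coincide_on[OF cons this(1) that(1) this(2)]
      show "coincide_on (nonzero_on I) (distr (N H) (real_space L) (\<lambda>x. restrict x L)) (N L)"
        by (rule coincide_on_subset) (use nonzero_on_mono[OF L(2)] in auto)
    qed
  qed (use that in \<open>auto simp: fin_subsets_def\<close>)
  have "\<exists>R. sets R = sets (real_space T) \<and>
    (\<forall>J. finite J \<longrightarrow> J \<subseteq> T \<longrightarrow> distr R (real_space J) (\<lambda>x. restrict x J) = Q J)"
  proof (rule kolmogorov_extension_finite)
    fix J assume J: "finite J" "J \<subseteq> T"
    show "finite_measure (Q J)"
      unfolding Q_def w_def using finite_density_weight[OF fd[OF JI[OF J]], of I] J IT sN[OF JI[OF J]]
      by (intro finite_measure.finite_measure_distr restrict_measurable[where T = "J \<union> I"]) auto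
  next
    fix J H assume JH: "J \<subseteq> H" "finite H" "H \<subseteq> T"
    have J: "finite J" "J \<subseteq> T" using JH finite_subset by auto
    note H' = JI[OF JH(2,3)] and J' = JI[OF J]
    have sH: "sets (density (N (H \<union> I)) w) = sets (real_space (H \<union> I))" using sN[OF H'] by simp
    have "Q J = distr (distr (density (N (H \<union> I)) w) (real_space (J \<union> I)) (\<lambda>x. restrict x (J \<union> I))) (real_space J) (\<lambda>x. restrict x J)"
      using cw[OF H' J' Un_upper2 Un_mono[OF JH(1) order_refl]] by (simp add: Q_def)
    also have "\<dots> = distr (density (N (H \<union> I)) w) (real_space J) (\<lambda>x. restrict x J)"
      using JH by (intro distr_restrict_restrict[OF sH]) auto
    also have "\<dots> = distr (Q H) (real_space J) (\<lambda>x. restrict x J)"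
      using JH unfolding Q_def by (intro distr_restrict_restrict[OF sH, symmetric]) auto
    finally show "Q J = distr (Q H) (real_space J) (\<lambda>x. restrict x J)" .
  qed
  then obtain R where sR: "sets R = sets (real_space T)"
    and R: "\<And>J. finite J \<Longrightarrow> J \<subseteq> T \<Longrightarrow> distr R (real_space J) (\<lambda>x. restrict x J) = Q J" by blast
  have spR: "space R = space (real_space T)" using sR by (rule sets_eq_imp_space_eq)
  define v where "v x = ennreal (inverse (weight I x))" for x
  have vm: "v \<in> borel_measurable (real_space S)" if "I \<subseteq> S" for S
    using weight_measurable[OF that] unfolding v_def by measurable
  have vR[measurable]: "v \<in> borel_measurable R" using vm[OF IT(1)] unfolding measurable_cong_sets[OF sR refl] .
  have v0: "v x = 0" if "x \<notin> nonzero_on I" for x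
    using weight_pos_iff[OF IT(2), of x] weight_nonneg[of I x] that by (simp add: v_def)
  define V where "V = density R v"
  have "extends_on T N I V"
    unfolding extends_on_def
  proof (intro conjI ballI impI)
    show sV: "sets V = sets (real_space T)" by (simp add: V_def sR)
    fix K assume K: "K \<in> fin_subsets T" "I \<subseteq> K"
    have KT: "K \<subseteq> T" "finite K" using fin_subsetsD[OF K(1)] by auto
    have KI: "K \<union> I = K" using K(2) by auto
    note rK = restrict_measurable[OF sR KT(1)]
    have QK: "Q K = density (N K) w"
    proof -
      have "Q K = distr (density (N K) w) (real_space K) (\<lambda>x. restrict x K)" by (simp add: Q_def KI)
      also have "\<dots> = density (N K) w" using cw[OF K(1) K(1) K(2)] by simp
      finally show ?thesis .
    qed
    show "coincide_on (nonzero_on I) (distr V (real_space K) (\<lambda>x. restrict x K)) (N K)"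
    proof (rule coincide_onI)
      show "sets (distr V (real_space K) (\<lambda>x. restrict x K)) = sets (N K)" by (simp add: sN K)
      fix B assume "B \<in> sets (distr V (real_space K) (\<lambda>x. restrict x K))" and Bn: "B \<subseteq> nonzero_on I"
      then have B: "B \<in> sets (real_space K)" by simp
      have "emeasure (distr V (real_space K) (\<lambda>x. restrict x K)) B = emeasure V ((\<lambda>x. restrict x K) -` B \<inter> space V)"
        using B restrict_measurable[OF sV KT(1)] by (simp add: emeasure_distr)
      also have "\<dots> = (\<integral>\<^sup>+x. v x * indicator ((\<lambda>x. restrict x K) -` B \<inter> space R) x \<partial>R)"
        using measurable_sets[OF rK B] by (simp add: V_def emeasure_density)
      also have "\<dots> = (\<integral>\<^sup>+x. (\<lambda>y. v y * indicator B y) (restrict x K) \<partial>R)"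
        by (rule nn_integral_cong) (auto simp: v_def weight_restrict[OF K(2)] split: split_indicator)
      also have "\<dots> = (\<integral>\<^sup>+y. v y * indicator B y \<partial>Q K)"
        using B vm[OF K(2)] unfolding R[OF KT(2,1), symmetric]
        by (subst nn_integral_distr[OF rK]) simp_all
      also have "\<dots> = emeasure (N K) B"
        unfolding QK v_def w_def
        using B Bn weight_measurable[OF K(2)] weight_pos_iff[OF IT(2)] sN[OF K(1)]
        by (intro emeasure_density_inverse) (auto simp: measurable_cong_sets[OF sN[OF K(1)] refl])
      finally show "emeasure (distr V (real_space K) (\<lambda>x. restrict x K)) B = emeasure (N K) B" .
    qed
  qed
  moreover have "emeasure V A = emeasure V (A \<inter> nonzero_on I)" if "A \<in> sets V" for A
  proof -
    have A: "A \<in> sets R" using that by (simp add: V_def)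
    have "A \<inter> nonzero_on I = A \<inter> (nonzero_on I \<inter> space R)" using sets.sets_into_space[OF A] by auto
    then have A': "A \<inter> nonzero_on I \<in> sets R"
      using nonzero_on_measurable[OF IT(1) countable_finite[OF IT(2)]] A sR spR by auto
    have "emeasure V A = (\<integral>\<^sup>+x. v x * indicator A x \<partial>R)" using A by (simp add: V_def emeasure_density)
    also have "\<dots> = (\<integral>\<^sup>+x. v x * indicator (A \<inter> nonzero_on I) x \<partial>R)"
      using v0 by (intro nn_integral_cong) (auto split: split_indicator)
    also have "\<dots> = emeasure V (A \<inter> nonzero_on I)" using A' by (simp add: V_def emeasure_density)
    finally show ?thesis .
  qed
  ultimately show ?thesis by blast
qed

section \<open>The Levy measure of a consistent system\<close>

lemma has_projections_iff_coincide_on: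
  assumes "sets \<rho> = sets (real_space T)" and "\<And>I. I \<in> fin_subsets T \<Longrightarrow> sets (N I) = sets (real_space I)"
  shows "has_projections T N \<rho> \<longleftrightarrow>
    (\<forall>I\<in>fin_subsets T. coincide_on (nonzero_on I) (distr \<rho> (real_space I) (\<lambda>x. restrict x I)) (N I))"
  using assms unfolding has_projections_def coincide_on_def by (auto simp: sets_off_origin_iff)

lemma has_projections_extends_on:
  assumes "consistent_levy_system T N" and s: "sets \<rho> = sets (real_space T)" and "has_projections T N \<rho>"
  shows "extends_on T N I \<rho>"
proof -
  have "\<And>K. K \<in> fin_subsets T \<Longrightarrow> sets (N K) = sets (real_space K)"
    using assms by (simp add: consistent_levy_system_def fd_levy_measure_def)
  then have "\<forall>K\<in>fin_subsets T. coincide_on (nonzero_on K) (distr \<rho> (real_space K) (\<lambda>x. restrict x K)) (N K)"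
    using has_projections_iff_coincide_on[OF s, of N] assms by blast
  then show ?thesis
    unfolding extends_on_def using s nonzero_on_mono coincide_on_subset by (metis le_infI1)
qed

text \<open>Membership in a set of the product \<open>\<sigma>\<close>-algebra is decided by countably many coordinates \<open>C\<close>. A
  member that vanished on \<open>C\<close> could not be told apart from the origin.\<close>

lemma off_origin_countable_cover:
  assumes D: "D \<in> sets (real_space T)" and 0: "origin T \<notin> D"
  shows "\<exists>C. countable C \<and> C \<subseteq> T \<and> D \<subseteq> nonzero_on C"
proof -
  define dep where "dep E C \<longleftrightarrow> countable C \<and> C \<subseteq> T \<and> (\<forall>x\<in>space (real_space T).
      \<forall>y\<in>space (real_space T). (\<forall>t\<in>C. x t = y t) \<longrightarrow> (x \<in> E \<longleftrightarrow> y \<in> E))" for E C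
  have "\<exists>C. dep D C"
    using D unfolding sets_PiM_single
  proof (induction rule: sigma_sets.induct)
    case (Basic E)
    then obtain i A where "i \<in> T" "E = {f \<in> \<Pi>\<^sub>E i\<in>T. space borel. f i \<in> A}" by blast
    then have "dep E {i}" by (auto simp: dep_def space_PiM)
    then show ?case ..
  next
    case Empty
    have "dep {} {}" by (simp add: dep_def)
    then show ?case ..
  next
    case (Compl E)
    then obtain C where C: "dep E C" by blast
    have "dep (space (real_space T) - E) C"
      unfolding dep_def
    proof (intro conjI ballI impI)
      fix x y assume xy: "x \<in> space (real_space T)" "y \<in> space (real_space T)" "\<forall>t\<in>C. x t = y t"
      have "x \<in> E \<longleftrightarrow> y \<in> E" using C xy unfolding dep_def by blast
      then show "x \<in> space (real_space T) - E \<longleftrightarrow> y \<in> space (real_space T) - E" using xy(1,2) by blast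
    qed (use C in \<open>auto simp: dep_def\<close>)
    then have "dep ((\<Pi>\<^sub>E i\<in>T. space borel) - E) C" by (simp add: space_PiM)
    then show ?case ..
  next
    case (Union E)
    then obtain C where C: "\<And>i. dep (E i) (C i)" by metis
    have "dep (\<Union>i. E i) (\<Union>i. C i)"
      unfolding dep_def
    proof (intro conjI ballI impI)
      fix x y assume xy: "x \<in> space (real_space T)" "y \<in> space (real_space T)" "\<forall>t\<in>\<Union>i. C i. x t = y t"
      have "x \<in> E i \<longleftrightarrow> y \<in> E i" for i using C[of i] xy unfolding dep_def by blast
      then show "x \<in> (\<Union>i. E i) \<longleftrightarrow> y \<in> (\<Union>i. E i)" by simp
    qed (use C in \<open>auto simp: dep_def\<close>)
    then show ?case ..
  qed
  then obtain C where C: "countable C" "C \<subseteq> T" and dep: "\<forall>x\<in>space (real_space T). \<forall>y\<in>space (real_space T).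
      (\<forall>t\<in>C. x t = y t) \<longrightarrow> (x \<in> D \<longleftrightarrow> y \<in> D)" unfolding dep_def by blast
  have "x \<in> nonzero_on C" if x: "x \<in> D" for x
  proof (rule ccontr)
    assume "x \<notin> nonzero_on C"
    then have "\<forall>t\<in>C. x t = origin T t" using C(2) by (auto simp: nonzero_on_def origin_def)
    moreover have "x \<in> space (real_space T)" using x sets.sets_into_space[OF D] by auto
    moreover have "origin T \<in> space (real_space T)" by (auto simp: origin_def space_PiM)
    ultimately show False using dep x 0 by blast
  qed
  then show ?thesis using C by blast
qed

text \<open>The complement of the origin may be non-measurable and is in general not a countable union of
  cylinders, but each measurable set inside it is covered by countably many of them.\<close>

lemma has_projections_coincide_on:
  assumes cons: "consistent_levy_system T N"
    and \<rho>: "sets \<rho> = sets (real_space T)" "has_projections T N \<rho>"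
    and \<sigma>: "sets \<sigma> = sets (real_space T)" "has_projections T N \<sigma>"
  shows "coincide_on (- {origin T}) \<rho> \<sigma>"
proof (rule coincide_onI)
  show s: "sets \<rho> = sets \<sigma>" using \<rho> \<sigma> by simp
  have sp: "space \<rho> = space (real_space T)" using \<rho>(1) by (rule sets_eq_imp_space_eq)
  fix D assume D: "D \<in> sets \<rho>" "D \<subseteq> - {origin T}"
  then obtain C where C: "countable C" "C \<subseteq> T" "D \<subseteq> nonzero_on C"
    using off_origin_countable_cover[of D T] \<rho>(1) by auto
  have "coincide_on (\<Union>t\<in>C. nonzero_on {t}) \<rho> \<sigma>"
  proof (rule coincide_on_countable_UN[OF C(1) s])
    fix t assume t: "t \<in> C"
    show "coincide_on (nonzero_on {t}) \<rho> \<sigma>"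
      using t C(2) by (intro extends_on_coincide_on[OF cons] has_projections_extends_on[OF cons] \<rho> \<sigma>)
        (auto simp: fin_subsets_def)
    show "nonzero_on {t} \<inter> space \<rho> \<in> sets \<rho>"
      using nonzero_on_measurable[of "{t}" T] t C(2) \<rho>(1) sp by auto
  qed
  moreover have "(\<Union>t\<in>C. nonzero_on {t}) = nonzero_on C" by (auto simp: nonzero_on_def)
  ultimately show "emeasure \<rho> D = emeasure \<sigma> D" using D(1) C(3) by (auto intro: coincide_onD)
qed

lemma inner_measure_coincide_on:
  assumes "coincide_on (- {z}) \<rho> \<sigma>"
  shows "inner_measure \<rho> (A - {z}) = inner_measure \<sigma> (A - {z})"
  using assms unfolding inner_measure_def coincide_on_def by (intro SUP_cong) auto

lemma levy_measure_unique:
  assumes cons: "consistent_levy_system T N"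
    and \<nu>: "levy_measure T \<nu>" "has_projections T N \<nu>" and \<mu>: "levy_measure T \<mu>" "has_projections T N \<mu>"
  shows "\<nu> = \<mu>"
proof (rule measure_eqI)
  have s: "sets \<nu> = sets (real_space T)" "sets \<mu> = sets (real_space T)"
    using \<nu> \<mu> by (auto simp: levy_measure_def)
  then show "sets \<nu> = sets \<mu>" by simp
  fix A assume A: "A \<in> sets \<nu>"
  have "inner_measure \<nu> (A - {origin T}) = inner_measure \<mu> (A - {origin T})"
    by (intro inner_measure_coincide_on has_projections_coincide_on[OF cons] s \<nu> \<mu>)
  then show "emeasure \<nu> A = emeasure \<mu> A"
    using \<nu>(1) \<mu>(1) A s by (simp add: levy_measure_def)
qed

text \<open>The integrand vanishes where \<open>x t = 0\<close>, so the integral sees only the part of the projection to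
  the coordinate \<open>t\<close> that is prescribed.\<close>

lemma one_dim_integrability_if_has_projections:
  assumes cons: "consistent_levy_system T N" and s: "sets \<nu> = sets (real_space T)"
    and p: "has_projections T N \<nu>" and t: "t \<in> T"
  shows "(\<integral>\<^sup>+ x. ennreal (min (\<bar>x t\<bar>\<^sup>2) 1) \<partial>\<nu>) < \<infinity>"
proof -
  have t': "{t} \<in> fin_subsets T" "{t} \<subseteq> T" using t by (auto simp: fin_subsets_def)
  have fd: "fd_levy_measure {t} (N {t})" using cons t' by (simp add: consistent_levy_system_def)
  have co: "coincide_on (nonzero_on {t}) (distr \<nu> (real_space {t}) (\<lambda>x. restrict x {t})) (N {t})"
    using has_projections_extends_on[OF cons s p] t' by (auto simp: extends_on_def)
  note w[measurable] = weight_measurable[of "{t}", OF order_refl]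
  have "(\<integral>\<^sup>+ x. ennreal (min (\<bar>x t\<bar>\<^sup>2) 1) \<partial>\<nu>) = (\<integral>\<^sup>+ x. ennreal (weight {t} (restrict x {t})) \<partial>\<nu>)"
    by (intro nn_integral_cong) (simp add: weight_def dot_def power2_eq_square)
  also have "\<dots> = (\<integral>\<^sup>+ x. ennreal (weight {t} x) \<partial>distr \<nu> (real_space {t}) (\<lambda>x. restrict x {t}))"
    by (subst nn_integral_distr[OF restrict_measurable[OF s t'(2)]]) simp_all
  also have "\<dots> = (\<integral>\<^sup>+ x. ennreal (weight {t} x) \<partial>N {t})"
    using nonzero_on_measurable[of "{t}" "{t}"]
    by (intro nn_integral_coincide_on[OF co]) (auto simp: weight_eq_0)
  also have "\<dots> < \<infinity>" using fd by (simp add: fd_levy_measure_def weight_def)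
  finally show ?thesis .
qed

text \<open>The pieces \<open>V I\<close> that extend the system on \<open>nonzero_on I\<close> grow with \<open>I\<close>, and a directed supremum
  of measures is a measure. Since \<open>V I\<close> lives on \<open>nonzero_on I\<close>, which misses the origin, the
  supremum satisfies the inner measure condition by construction.\<close>

lemma exists_levy_measure:
  assumes cons: "consistent_levy_system T N"
  shows "\<exists>\<nu>. levy_measure T \<nu> \<and> has_projections T N \<nu>"
proof -
  obtain V where V: "\<And>I. I \<in> fin_subsets T \<Longrightarrow> extends_on T N I (V I)"
    and V_conc: "\<And>I A. I \<in> fin_subsets T \<Longrightarrow> A \<in> sets (V I) \<Longrightarrow> emeasure (V I) A = emeasure (V I) (A \<inter> nonzero_on I)"
    using exists_extends_on[OF cons] by metis
  have sV: "sets (V I) = sets (real_space T)" if "I \<in> fin_subsets T" for I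
    using V[OF that] by (simp add: extends_on_def)
  have nz: "A \<inter> nonzero_on I \<in> sets (real_space T)"
    if "A \<in> sets (real_space T)" "I \<in> fin_subsets T" for A I
  proof -
    have "A \<inter> nonzero_on I = A \<inter> (nonzero_on I \<inter> space (real_space T))"
      using sets.sets_into_space[OF that(1)] by auto
    then show ?thesis using that nonzero_on_measurable[of I T] fin_subsetsD[OF that(2)] countable_finite by auto
  qed
  have mono: "emeasure (V I) A \<le> emeasure (V J) A"
    if I: "I \<in> fin_subsets T" and J: "J \<in> fin_subsets T" and IJ: "I \<subseteq> J" and A: "A \<in> sets (real_space T)" for I J A
  proof -
    have "emeasure (V I) A = emeasure (V I) (A \<inter> nonzero_on I)" using V_conc[OF I] A sV[OF I] by simp
    also have "\<dots> = emeasure (V J) (A \<inter> nonzero_on I)"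
      using extends_on_coincide_on[OF cons I V[OF I] extends_on_mono[OF cons J IJ V[OF J]]] nz[OF A I] sV[OF I]
      by (intro coincide_onD) auto
    also have "\<dots> \<le> emeasure (V J) A" using A sV[OF J] by (intro emeasure_mono) auto
    finally show ?thesis .
  qed
  define m where "m A = (SUP I\<in>fin_subsets T. emeasure (V I) A)" for A
  define \<nu> where "\<nu> = measure_of (space (real_space T)) (sets (real_space T)) m"
  have s: "sets \<nu> = sets (real_space T)" by (simp add: \<nu>_def)
  have sp: "space \<nu> = space (real_space T)" using s by (rule sets_eq_imp_space_eq)
  have \<nu>: "emeasure \<nu> A = m A" if A: "A \<in> sets (real_space T)" for A
    unfolding \<nu>_def
  proof (rule emeasure_measure_of_sigma[OF sets.sigma_algebra_axioms _ _ A])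
    show "positive (sets (real_space T)) m" 
    proof -
      have "m {} \<le> 0" unfolding m_def by (rule SUP_least) simp
      then show ?thesis by (simp add: positive_def)
    qed
    show "countably_additive (sets (real_space T)) m"
    proof (rule countably_additiveI)
      fix B :: "nat \<Rightarrow> _" assume B: "range B \<subseteq> sets (real_space T)" "disjoint_family B"
      have "(\<Sum>n. m (B n)) = (SUP I\<in>fin_subsets T. \<Sum>n. emeasure (V I) (B n))"
        unfolding m_def
      proof (rule ennreal_suminf_SUP_eq_directed)
        fix L :: "nat set" and I J assume I: "I \<in> fin_subsets T" and J: "J \<in> fin_subsets T"
        show "\<exists>K\<in>fin_subsets T. \<forall>n\<in>L. emeasure (V I) (B n) \<le> emeasure (V K) (B n) \<and> emeasure (V J) (B n) \<le> emeasure (V K) (B n)"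
          using B(1) by (intro bexI[OF _ fin_subsets_Un[OF I J]] ballI conjI mono I J fin_subsets_Un) auto
      qed
      also have "\<dots> = m (\<Union>n. B n)"
        unfolding m_def using B sV by (intro SUP_cong refl suminf_emeasure) auto
      finally show "(\<Sum>n. m (B n)) = m (\<Union>n. B n)" .
    qed
  qed
  have proj: "has_projections T N \<nu>"
    unfolding has_projections_def
  proof (intro ballI)
    fix I B assume I: "I \<in> fin_subsets T" and "B \<in> sets_off_origin I"
    then have B: "B \<in> sets (real_space I)" "B \<subseteq> nonzero_on I" by (auto simp: sets_off_origin_iff)
    have IT: "I \<subseteq> T" using fin_subsetsD[OF I] by simp
    define C where "C = (\<lambda>x. restrict x I) -` B \<inter> space (real_space T)"
    have C: "C \<in> sets (real_space T)" unfolding C_def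
      using measurable_sets[OF restrict_measurable[OF refl IT] B(1)] .
    have VC: "emeasure (V J) C = emeasure (N I) B" if J: "J \<in> fin_subsets T" "I \<subseteq> J" for J
    proof -
      have "coincide_on (nonzero_on I) (distr (V J) (real_space I) (\<lambda>x. restrict x I)) (N I)"
        using extends_on_mono[OF cons J V[OF J(1)]] I by (auto simp: extends_on_def)
      from coincide_onD[OF this _ B(2)] B(1)
      show ?thesis using restrict_measurable[OF sV[OF J(1)] IT] sets_eq_imp_space_eq[OF sV[OF J(1)]]
        by (simp add: emeasure_distr C_def)
    qed
    \<comment> \<open>Every finite index set can be enlarged to contain \<open>I\<close>, and from there on the value is constant.\<close>
    have "m C = emeasure (N I) B"
    proof (rule antisym)
      show "m C \<le> emeasure (N I) B"
        unfolding m_def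
      proof (rule SUP_least)
        fix J assume J: "J \<in> fin_subsets T"
        show "emeasure (V J) C \<le> emeasure (N I) B"
          using mono[OF J fin_subsets_Un[OF I J] _ C] VC[OF fin_subsets_Un[OF I J]] by simp
      qed
      show "emeasure (N I) B \<le> m C"
        unfolding m_def VC[OF I order_refl, symmetric] by (rule SUP_upper[OF I])
    qed
    then show "emeasure (distr \<nu> (real_space I) (\<lambda>x. restrict x I)) B = emeasure (N I) B"
      using B(1) \<nu>[OF C] restrict_measurable[OF s IT] by (simp add: emeasure_distr sp C_def)
  qed
  have "emeasure \<nu> A = inner_measure \<nu> (A - {origin T})" if A: "A \<in> sets (real_space T)" for A
  proof (rule antisym)
    show "emeasure \<nu> A \<le> inner_measure \<nu> (A - {origin T})"
      unfolding \<nu>[OF A] m_def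
    proof (rule SUP_least)
      fix I assume I: "I \<in> fin_subsets T"
      have "emeasure (V I) A = emeasure (V I) (A \<inter> nonzero_on I)" using V_conc[OF I] A sV[OF I] by simp
      also have "\<dots> \<le> emeasure \<nu> (A \<inter> nonzero_on I)"
        unfolding \<nu>[OF nz[OF A I]] m_def by (rule SUP_upper[OF I])
      also have "\<dots> \<le> inner_measure \<nu> (A - {origin T})"
        unfolding inner_measure_def using nz[OF A I] s fin_subsetsD[OF I]
        by (intro SUP_upper) (auto simp: nonzero_on_def origin_def)
      finally show "emeasure (V I) A \<le> inner_measure \<nu> (A - {origin T})" .
    qed
    show "inner_measure \<nu> (A - {origin T}) \<le> emeasure \<nu> A"
      unfolding inner_measure_def using A s by (intro SUP_least emeasure_mono) auto
  qed
  then have "levy_measure T \<nu>"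
    unfolding levy_measure_def using s one_dim_integrability_if_has_projections[OF cons s proj] by blast
  then show ?thesis using proj by blast
qed

section \<open>Fourier uniqueness in finitely many coordinates\<close>

lemma dot_restrict: "dot I (restrict a I) x = dot I a x" "dot I a (restrict x I) = dot I a x"
  by (auto simp: dot_def intro: sum.cong)

lemma dot_measurable[measurable]: "dot I a \<in> borel_measurable (real_space I)"
  unfolding dot_def by measurable

lemma dot_single:
  assumes "finite I" "t \<in> I"
  shows "dot I (\<lambda>i. if i = t then r else 0) x = r * x t"
proof -
  have "dot I (\<lambda>i. if i = t then r else 0) x = (\<Sum>i\<in>I. if i = t then r * x t else 0)"
    unfolding dot_def by (rule sum.cong) auto
  then show ?thesis using assms by simp
qed

lemma dot_add: "dot I (\<lambda>i. a i + u i) x = dot I a x + dot I u x"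
  and dot_diff: "dot I (\<lambda>i. a i - u i) x = dot I a x - dot I u x"
  by (simp_all add: dot_def ring_distribs sum.distrib sum_subtractf)

lemma dot_scaleR: "dot I (\<lambda>i. s * a i) x = s * dot I a x"
  by (simp add: dot_def sum_distrib_left mult.assoc)

text \<open>The uniqueness theorem for characteristic functions of probability measures, applied after
  normalisation by the common total mass, which is the value of the transform at zero.\<close>

lemma finite_measure_eq_if_char_eq:
  assumes fin: "finite_measure M" "finite_measure N"
    and s: "sets M = sets borel" "sets N = sets borel"
    and char: "char M = char N"
  shows "M = N"
proof -
  interpret M: finite_measure M by fact
  interpret N: finite_measure N by fact
  have sp: "space M = UNIV" "space N = UNIV"
    using s[THEN sets_eq_imp_space_eq] by simp_all
  define c where "c = measure M UNIV"
  have cN: "c = measure N UNIV"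
  proof -
    have "char M 0 = char N 0" using char by simp
    then show ?thesis by (simp add: char_def sp c_def)
  qed
  show ?thesis
  proof (cases "c = 0")
    case True
    have "emeasure M A = 0" "emeasure N A = 0" for A
      using True cN M.emeasure_eq_measure[of A] N.emeasure_eq_measure[of A]
        M.bounded_measure[of A] N.bounded_measure[of A] measure_nonneg[of M A] measure_nonneg[of N A]
      by (auto simp: c_def sp)
    then show ?thesis using s by (intro measure_eqI) auto
  next
    case False
    then have c: "c > 0" by (simp add: c_def order_less_le)
    have rd: "real_distribution (density P (\<lambda>_. ennreal (inverse c)))"
      and ch: "char (density P (\<lambda>_. ennreal (inverse c))) t = inverse c * char P t"
      if P: "finite_measure P" "sets P = sets borel" "measure P UNIV = c" for P t
    proof -
      interpret P: finite_measure P by fact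
      have sP: "space P = UNIV" using P(2)[THEN sets_eq_imp_space_eq] by simp
      have m[measurable]: "(\<lambda>x. iexp (t * x)) \<in> borel_measurable P"
        unfolding measurable_cong_sets[OF P(2) refl] by measurable
      have [measurable]: "(\<lambda>x. exp (\<i> * (complex_of_real t * complex_of_real x))) \<in> borel_measurable P"
        using m by simp
      have "emeasure (density P (\<lambda>_. ennreal (inverse c))) UNIV = ennreal (inverse c) * ennreal c"
        using P P.emeasure_eq_measure[of UNIV] sP by (subst emeasure_density) (auto simp: nn_integral_cmult sP)
      also have "\<dots> = 1" using c by (simp add: ennreal_mult[symmetric])
      finally have e: "emeasure (density P (\<lambda>_. ennreal (inverse c))) UNIV = 1" .
      show "real_distribution (density P (\<lambda>_. ennreal (inverse c)))"
        by (intro real_distribution.intro prob_spaceI real_distribution_axioms.intro)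
           (simp_all add: e sP P(2))
      show "char (density P (\<lambda>_. ennreal (inverse c))) t = inverse c * char P t"
        unfolding char_def using c by (subst integral_density) (auto simp: scaleR_conv_of_real)
    qed
    have eq: "density M (\<lambda>_. ennreal (inverse c)) = density N (\<lambda>_. ennreal (inverse c))"
    proof (intro Levy_uniqueness rd)
      show "char (density M (\<lambda>_. ennreal (inverse c))) = char (density N (\<lambda>_. ennreal (inverse c)))"
        using char cN ch[OF fin(1) s(1)] ch[OF fin(2) s(2)] by (simp add: fun_eq_iff c_def)
    qed (simp_all add: s fin cN[symmetric], simp add: c_def)
    have "coincide_on {x. inverse c > 0} M N"
      by (rule coincide_on_if_density_eq) (use s eq in auto)
    then show ?thesis using c s
      by (intro measure_eqI) (auto simp: coincide_on_def)
  qed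
qed

text \<open>This conditions on one real coordinate \<open>X\<close> and is the induction step for several coordinates. It is
  a uniqueness statement for the complex measure of density \<open>g\<close> pushed forward by \<open>X\<close>. To
  reduce it to positive measures, use the densities \<open>h + Re (z g)\<close> with \<open>|z| \<le> 1\<close>, which are
  nonnegative because \<open>|g| \<le> h\<close>; the values \<open>0\<close>, \<open>1\<close> and \<open>-i\<close> of \<open>z\<close> then isolate the real and
  imaginary parts of \<open>g\<close>.\<close>

lemma integral_slice_eq_if_fourier_eq:
  fixes h :: "'a \<Rightarrow> real" and g :: "'a \<Rightarrow> complex" and X :: "'a \<Rightarrow> real"
  assumes s: "sets M = sets N"
    and m[measurable]: "h \<in> borel_measurable M" "g \<in> borel_measurable M" "X \<in> borel_measurable M"
    and int: "integrable M h" "integrable N h"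
    and le: "\<And>x. x \<in> space M \<Longrightarrow> norm (g x) \<le> h x"
    and eqh: "\<And>t. (CLINT x|M. h x * iexp (t * X x)) = (CLINT x|N. h x * iexp (t * X x))"
    and eqg: "\<And>t. (CLINT x|M. g x * iexp (t * X x)) = (CLINT x|N. g x * iexp (t * X x))"
    and eqc: "\<And>t. (CLINT x|M. cnj (g x) * iexp (t * X x)) = (CLINT x|N. cnj (g x) * iexp (t * X x))"
    and A[measurable]: "A \<in> sets borel"
  shows "(CLINT x|M. g x * indicator A (X x)) = (CLINT x|N. g x * indicator A (X x))"
proof -
  have sp: "space M = space N" using s sets_eq_imp_space_eq by auto
  define k where "k z x = h x + Re (z * g x)" for z x
  have mk: "k z \<in> borel_measurable M" for z unfolding k_def by measurable
  note mN[measurable] = m[unfolded measurable_cong_sets[OF s refl]] and mkN = mk[unfolded measurable_cong_sets[OF s refl]]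
  have k0: "0 \<le> k z x" if "norm z \<le> 1" "x \<in> space M" for z x
  proof -
    have "\<bar>Re (z * g x)\<bar> \<le> norm z * norm (g x)"
      using abs_Re_le_cmod[of "z * g x"] by (simp add: norm_mult)
    also have "\<dots> \<le> 1 * h x"
      using that le[OF that(2)] by (intro mult_mono) auto
    finally show ?thesis by (simp add: k_def)
  qed
  have intg: "integrable M g" "integrable N g"
    by (rule Bochner_Integration.integrable_bound[OF int(1)], simp, rule AE_I2, use le in fastforce)
       (rule Bochner_Integration.integrable_bound[OF int(2)], simp, rule AE_I2, use le sp in fastforce)
  have intk: "integrable M (k z)" "integrable N (k z)" for z
    unfolding k_def using intg int by auto
  have main: "(LINT x|M. k z x * indicator A (X x)) = (LINT x|N. k z x * indicator A (X x))"
    if z: "norm z \<le> 1" for z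
  proof -
    define L where "L P = distr (density P (\<lambda>x. ennreal (k z x))) borel X" for P
    have fm: "finite_measure (L P)" if "sets P = sets M" "integrable P (k z)" for P
    proof -
      have [measurable]: "k z \<in> borel_measurable P" "X \<in> borel_measurable P"
        using mk m(3) unfolding measurable_cong_sets[OF that(1) refl] by auto
      have sP: "space P = space M" using that sets_eq_imp_space_eq by auto
      have "emeasure (density P (\<lambda>x. ennreal (k z x))) (space P) = (\<integral>\<^sup>+x. ennreal (k z x) \<partial>P)"
        by (subst emeasure_density) (auto intro!: nn_integral_cong)
      also have "\<dots> = ennreal (LINT x|P. k z x)"
        using that k0[OF z] sP by (intro nn_integral_eq_integral) auto
      finally have "finite_measure (density P (\<lambda>x. ennreal (k z x)))"
        by (intro finite_measureI) auto
      then show ?thesis unfolding L_def by (intro finite_measure.finite_measure_distr) auto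
    qed
    have ch: "char (L P) t = (CLINT x|P. h x * iexp (t * X x)) + z/2 * (CLINT x|P. g x * iexp (t * X x))
       + cnj z/2 * (CLINT x|P. cnj (g x) * iexp (t * X x))"
      if P: "sets P = sets M" "integrable P h" "integrable P g" for P t
    proof -
      have [measurable]: "k z \<in> borel_measurable P" "X \<in> borel_measurable P" "h \<in> borel_measurable P" "g \<in> borel_measurable P"
        using mk m unfolding measurable_cong_sets[OF that(1) refl] by auto
      have [measurable]: "(\<lambda>x. cnj (g x)) \<in> borel_measurable P"
        by (rule measurable_compose[of g P borel cnj]) (auto intro!: borel_measurable_continuous_onI continuous_intros)
      have sP: "space P = space M" using that sets_eq_imp_space_eq by auto
      have i1: "integrable P (\<lambda>x. complex_of_real (h x) * iexp (t * X x))"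
        by (rule Bochner_Integration.integrable_bound[OF P(2)]) (auto simp: norm_mult)
      have i2: "integrable P (\<lambda>x. g x * iexp (t * X x))" "integrable P (\<lambda>x. cnj (g x) * iexp (t * X x))"
        by (rule Bochner_Integration.integrable_bound[OF P(3)]; auto simp: norm_mult)+
      have "char (L P) t = (CLINT x|P. k z x *\<^sub>R iexp (t * X x))"
        unfolding char_def L_def
        by (subst integral_distr, measurable, subst integral_density) (auto intro!: AE_I2 k0[OF z] simp: sP)
      also have "\<dots> = (CLINT x|P. h x * iexp (t * X x) + z/2 * (g x * iexp (t * X x))
          + cnj z/2 * (cnj (g x) * iexp (t * X x)))"
      proof (rule Bochner_Integration.integral_cong[OF refl])
        fix x
        have "complex_of_real (Re (z * g x)) = (z * g x + cnj (z * g x)) / 2"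
          by (simp add: complex_eq_iff)
        then have "complex_of_real (k z x) = h x + (z * g x + cnj z * cnj (g x)) / 2"
          by (simp add: k_def)
        then show "k z x *\<^sub>R iexp (t * X x) = h x * iexp (t * X x) + z/2 * (g x * iexp (t * X x))
          + cnj z/2 * (cnj (g x) * iexp (t * X x))"
          unfolding scaleR_conv_of_real by (simp add: algebra_simps add_divide_distrib)
      qed
      also have "\<dots> = (CLINT x|P. h x * iexp (t * X x)) + z/2 * (CLINT x|P. g x * iexp (t * X x))
       + cnj z/2 * (CLINT x|P. cnj (g x) * iexp (t * X x))"
        using i1 i2 by simp
      finally show ?thesis .
    qed
    have "char (L M) = char (L N)"
      unfolding ch[OF refl int(1) intg(1)] ch[OF s[symmetric] int(2) intg(2)] fun_eq_iff eqh eqg eqc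
      by simp
    then have LL: "L M = L N"
      by (intro finite_measure_eq_if_char_eq fm intk refl s[symmetric]) (simp_all add: L_def)
    have I: "(LINT x|P. k z x * indicator A (X x)) = measure (L P) A" 
      if P: "sets P = sets M" for P
    proof -
      have [measurable]: "k z \<in> borel_measurable P" "X \<in> borel_measurable P"
        using mk m unfolding measurable_cong_sets[OF that(1) refl] by auto
      have sP: "space P = space M" using that sets_eq_imp_space_eq by auto
      have "measure (L P) A = (LINT y|L P. indicator A y)"
        by (simp add: L_def)
      also have "\<dots> = (LINT x|P. k z x *\<^sub>R indicator A (X x))"
        unfolding L_def 
        by (subst integral_distr, measurable, subst integral_density) (auto intro!: AE_I2 k0[OF z] simp: sP)
      finally show ?thesis by simp
    qed
    show ?thesis using I[of M] I[of N] LL s by simp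
  qed
  have mI[measurable]: "(\<lambda>x. indicat_real A (X x)) \<in> borel_measurable M" "(\<lambda>x. indicat_real A (X x)) \<in> borel_measurable N"
    by measurable
  have split: "(LINT x|P. k z x * indicator A (X x)) =
       (LINT x|P. h x * indicator A (X x)) + Re (z * (CLINT x|P. g x * indicator A (X x)))"
    if P: "sets P = sets M" "integrable P h" "integrable P g" for P z
  proof -
    have [measurable]: "X \<in> borel_measurable P" "h \<in> borel_measurable P" "g \<in> borel_measurable P"
      using m unfolding measurable_cong_sets[OF that(1) refl] by auto
    have i1: "integrable P (\<lambda>x. h x * indicator A (X x))"
      by (rule Bochner_Integration.integrable_bound[OF P(2)]) (auto split: split_indicator)
    have i2: "integrable P (\<lambda>x. g x * indicator A (X x))"
      by (rule Bochner_Integration.integrable_bound[OF P(3)]) (auto split: split_indicator)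
    have "(LINT x|P. k z x * indicator A (X x)) = (LINT x|P. h x * indicator A (X x) + Re (z * (g x * indicator A (X x))))"
      by (rule Bochner_Integration.integral_cong) (auto simp: k_def split: split_indicator)
    also have "\<dots> = (LINT x|P. h x * indicator A (X x)) + (LINT x|P. Re (z * (g x * indicator A (X x))))"
      using i1 integrable_Re[OF integrable_mult_right[OF i2, of z]]
      by (intro Bochner_Integration.integral_add) blast+
    also have "(LINT x|P. Re (z * (g x * indicator A (X x)))) = Re (CLINT x|P. z * (g x * indicator A (X x)))"
      using i2 by (intro integral_Re) auto
    finally show ?thesis by simp
  qed
  have r: "(LINT x|M. h x * indicator A (X x)) + Re (z * (CLINT x|M. g x * indicator A (X x)))
      = (LINT x|N. h x * indicator A (X x)) + Re (z * (CLINT x|N. g x * indicator A (X x)))" if "norm z \<le> 1" for z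
    using main[OF that] split[of M z] split[of N z] int intg s by simp
  show ?thesis
    using r[of 0] r[of 1] r[of "-\<i>"] by (intro complex_eqI) auto
qed

text \<open>The exponentials are traded for indicator functions one coordinate at a time, by the one-dimensional
  uniqueness theorem, while the frequency stays arbitrary. When all
  coordinates are used up, the measures agree on rectangles.\<close>

lemma finite_measure_eq_if_fourier_eq:
  assumes I: "finite I" and fin: "finite_measure M" "finite_measure N"
    and s: "sets M = sets (real_space I)" "sets N = sets (real_space I)"
    and eq: "\<And>a. a \<in> space (real_space I) \<Longrightarrow> 
      (CLINT x|M. iexp (dot I a x)) = (CLINT x|N. iexp (dot I a x))"
  shows "M = N"
proof -
  interpret M: finite_measure M by fact
  interpret N: finite_measure N by fact
  have sp: "space M = space (real_space I)" "space N = space (real_space I)" 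
    using s[THEN sets_eq_imp_space_eq] .
  have sMN: "sets M = sets N" using s by simp
  have e: "(CLINT x|M. iexp (dot I a x)) = (CLINT x|N. iexp (dot I a x))" for a
    using eq[of "restrict a I"] by (simp add: dot_restrict space_PiM)
  define w where "w J A x = indicat_real {x \<in> space (real_space I). \<forall>j\<in>J. x j \<in> A j} x" for J and A :: "_ \<Rightarrow> real set" and x
  have wm: "w J A \<in> borel_measurable (real_space I)" 
    if "J \<subseteq> I" "\<And>j. j \<in> J \<Longrightarrow> A j \<in> sets borel" for J A
  proof -
    have [measurable]: "finite J" "\<And>j. j \<in> J \<Longrightarrow> A j \<in> sets borel" using that I finite_subset by auto
    have [measurable]: "(\<lambda>x. x j) \<in> measurable (real_space I) borel" if "j \<in> J" for j
      using that \<open>J \<subseteq> I\<close> by (auto intro: measurable_component_singleton)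
    have "{x \<in> space (real_space I). \<forall>j\<in>J. x j \<in> A j} \<in> sets (real_space I)"
      by measurable
    then show ?thesis unfolding w_def by measurable
  qed
  have claim: "(CLINT x|M. w J A x * iexp (dot I a x)) = (CLINT x|N. w J A x * iexp (dot I a x))"
    if "J \<subseteq> I" "\<And>j. j \<in> J \<Longrightarrow> A j \<in> sets borel" for J A a
    using finite_subset[OF that(1) I] that
  proof (induction J arbitrary: a rule: finite_induct)
    case empty
    have "(CLINT x|P. w {} A x * iexp (dot I a x)) = (CLINT x|P. iexp (dot I a x))"
      if "space P = space (real_space I)" for P
      by (rule Bochner_Integration.integral_cong) (auto simp: w_def that)
    then show ?case using e sp by simp
  next
    case (insert j J)
    have j: "j \<in> I" "J \<subseteq> I" "A j \<in> sets borel" using insert.prems by auto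
    have [measurable]: "w J A \<in> borel_measurable M" "w J A \<in> borel_measurable N"
      unfolding measurable_cong_sets[OF s(1) refl] measurable_cong_sets[OF s(2) refl]
      using wm insert.prems by auto
    have [measurable]: "(\<lambda>x. x j) \<in> borel_measurable M" "dot I b \<in> borel_measurable M" for b
      unfolding measurable_cong_sets[OF s(1) refl] using j by measurable
    have wle: "norm (w J A x) \<le> 1" for x by (auto simp: w_def split: split_indicator)
    define d where "d t i = (if i = j then t else 0 :: real)" for t i
    have shift: "dot I b x + t * x j = dot I (\<lambda>i. b i + d t i) x" for b t x
      using dot_single[OF I j(1), of t x] by (simp add: dot_add d_def)
    have IH: "(CLINT x|M. w J A x * iexp (dot I b x)) = (CLINT x|N. w J A x * iexp (dot I b x))" for b
      using insert.IH[of b] insert.prems by simp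
    have IH': "(CLINT x|M. w J A x * iexp (dot I b x) * iexp (t * x j)) = (CLINT x|N. w J A x * iexp (dot I b x) * iexp (t * x j))" for b t
    proof -
      have *: "complex_of_real (w J A x) * iexp (dot I b x) * iexp (t * x j) = w J A x * iexp (dot I (\<lambda>i. b i + d t i) x)" for x
        unfolding shift[symmetric] by (simp add: exp_add ring_distribs mult.assoc)
      show ?thesis unfolding * by (rule IH)
    qed
    have neg: "- dot I a x = dot I (\<lambda>i. - a i) x" for x by (simp add: dot_def sum_negf)
    have cnj: "cnj (complex_of_real (w J A x) * iexp (dot I a x)) = w J A x * iexp (dot I (\<lambda>i. - a i) x)" for x
      unfolding neg[symmetric] by (simp add: exp_cnj)
    have "(CLINT x|M. w J A x * iexp (dot I a x) * of_real (indicator (A j) (x j))) = (CLINT x|N. w J A x * iexp (dot I a x) * of_real (indicator (A j) (x j)))"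
      unfolding of_real_indicator
    proof (rule integral_slice_eq_if_fourier_eq[where h = "w J A"])
      show "integrable M (w J A)" by (rule M.integrable_const_bound[where B=1]) (use wle in \<open>auto intro: AE_I2\<close>)
      show "integrable N (w J A)" by (rule N.integrable_const_bound[where B=1]) (use wle in \<open>auto intro: AE_I2\<close>)
      show "(CLINT x|M. w J A x * iexp (t * x j)) = (CLINT x|N. w J A x * iexp (t * x j))" for t
        using IH'[of "\<lambda>_. 0" t] by (simp add: dot_def)
      show "norm (w J A x * iexp (dot I a x)) \<le> w J A x" for x
        by (simp add: norm_mult w_def)
      show "(CLINT x|M. cnj (w J A x * iexp (dot I a x)) * iexp (t * x j)) =
          (CLINT x|N. cnj (w J A x * iexp (dot I a x)) * iexp (t * x j))" for t
        unfolding cnj by (rule IH')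
      show "(\<lambda>x. complex_of_real (w J A x) * iexp (dot I a x)) \<in> borel_measurable M"
        by measurable
      show "w J A \<in> borel_measurable M" "(\<lambda>x. x j) \<in> borel_measurable M" by measurable
    qed (rule sMN IH' j)+
    moreover have "w (insert j J) A x = w J A x * indicator (A j) (x j)" for x
      by (auto simp: w_def split: split_indicator)
    ultimately show ?case
      by (simp only: of_real_mult of_real_indicator mult.assoc mult.commute[of _ "iexp _"])
  qed
  show ?thesis
  proof (rule measure_eqI_PiM_finite[OF I s])
    fix A assume A: "\<And>i. i \<in> I \<Longrightarrow> A i \<in> sets (borel :: real measure)"
    have E: "emeasure P (Pi\<^sub>E I A) = ennreal (measure P (Pi\<^sub>E I A))" "complex_of_real (measure P (Pi\<^sub>E I A)) = (CLINT x|P. w I A x * iexp (dot I (\<lambda>_. 0) x))"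
      if P: "finite_measure P" "sets P = sets (real_space I)" for P
    proof -
      interpret P: finite_measure P by fact
      have sP: "space P = space (real_space I)" using P sets_eq_imp_space_eq by auto
      have wI: "w I A x = indicator (Pi\<^sub>E I A) x" for x
        by (auto simp: w_def space_PiM PiE_iff split: split_indicator)
      have [measurable]: "Pi\<^sub>E I A \<in> sets P" using A I P by simp
      show "emeasure P (Pi\<^sub>E I A) = ennreal (measure P (Pi\<^sub>E I A))" by (rule P.emeasure_eq_measure)
      have "(CLINT x|P. w I A x * iexp (dot I (\<lambda>_. 0) x)) = (CLINT x|P. complex_of_real (indicator (Pi\<^sub>E I A) x))"
        by (simp add: dot_def wI)
      also have "\<dots> = complex_of_real (measure P (Pi\<^sub>E I A))"
        unfolding integral_complex_of_real by simp
      finally show "complex_of_real (measure P (Pi\<^sub>E I A)) = (CLINT x|P. w I A x * iexp (dot I (\<lambda>_. 0) x))" by simp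
    qed
    have "complex_of_real (measure M (Pi\<^sub>E I A)) = complex_of_real (measure N (Pi\<^sub>E I A))"
      using E(2)[OF fin(1) s(1)] E(2)[OF fin(2) s(2)] claim[of I A "\<lambda>_. 0"] A by simp
    then show "emeasure M (Pi\<^sub>E I A) = emeasure N (Pi\<^sub>E I A)"
      using E(1)[OF fin(1) s(1)] E(1)[OF fin(2) s(2)] by simp
  next
    show "range (\<lambda>n::nat. \<Pi>\<^sub>E i\<in>I. UNIV) \<subseteq> prod_algebra I (\<lambda>_. borel)"
      using I by (auto intro: prod_algebraI_finite)
    show "(\<Union>n::nat. \<Pi>\<^sub>E i\<in>I. UNIV) = space (real_space I)" by (simp add: space_PiM)
  qed simp
qed

text \<open>The values of \<open>h\<close> lie in the discrete set of multiples of \<open>2 \<pi> i\<close>, so continuity makes \<open>h\<close> constant.\<close>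

lemma exp_continuous_eq_1_imp_0:
  fixes h :: "real \<Rightarrow> complex"
  assumes cont: "continuous_on UNIV h" and e: "\<And>s. exp (h s) = 1" and real: "Im (h 0) = 0"
  shows "h s = 0"
proof -
  have h: "Re (h s) = 0" "\<exists>n::int. Im (h s) = of_int (2 * n) * pi" for s
    using e[of s] by (auto simp: exp_eq_1)
  have h0: "h 0 = 0" using h(1)[of 0] real by (simp add: complex_eq_iff)
  have "h constant_on UNIV"
  proof (rule continuous_discrete_range_constant[OF connected_UNIV cont])
    fix s :: real
    have "1 \<le> norm (h r - h s)" if "h r \<noteq> h s" for r
    proof -
      obtain n m :: int where nm: "Im (h r) = of_int (2 * n) * pi" "Im (h s) = of_int (2 * m) * pi"
        using h(2) by meson
      then have "n \<noteq> m" using that h(1) by (auto simp: complex_eq_iff)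
      then have "1 \<le> \<bar>real_of_int (n - m)\<bar>" by linarith
      then have "1 * 1 \<le> \<bar>real_of_int (n - m)\<bar> * (2 * pi)" using pi_ge_two by (intro mult_mono) auto
      also have "\<dots> = \<bar>Im (h r - h s)\<bar>" 
        using abs_mult[of "real_of_int (n - m)" "2 * pi"] by (simp add: nm algebra_simps)
      also have "\<dots> \<le> norm (h r - h s)" by (rule abs_Im_le_cmod)
      finally show ?thesis by simp
    qed
    then show "\<exists>e>0. \<forall>y. y \<in> UNIV \<and> h y \<noteq> h s \<longrightarrow> e \<le> norm (h y - h s)"
      by (intro exI[of _ 1]) auto
  qed
  then show ?thesis using h0 by (auto simp: constant_on_def)
qed

text \<open>Up to a constant factor, the exponential of the transform of a finite measure is the characteristic
  function of the compound Poisson law with this jump measure. The two transforms differ by a multiple of \<open>2 \<pi> i\<close> that varies continuously along rays and is real at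
  the origin, where the transforms are the total masses.\<close>

lemma finite_measure_eq_if_exp_fourier_eq:
  assumes I: "finite I" and fin: "finite_measure M" "finite_measure N"
    and s: "sets M = sets (real_space I)" "sets N = sets (real_space I)"
    and eq: "\<And>a. exp (CLINT x|M. iexp (dot I a x)) = exp (CLINT x|N. iexp (dot I a x))"
  shows "M = N"
proof (rule finite_measure_eq_if_fourier_eq[OF I fin s])
  fix a
  define F where "F P t = (CLINT x|P. iexp (t * dot I a x))" for P t
  have cont: "continuous_on UNIV (F P)" if P: "finite_measure P" "sets P = sets (real_space I)" for P
  proof (rule continuous_at_imp_continuous_on, rule ballI)
    interpret P: finite_measure P by fact
    have [measurable]: "dot I a \<in> borel_measurable P"
      unfolding measurable_cong_sets[OF P(2) refl] by (rule dot_measurable)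
    fix t show "isCont (F P) t"
      unfolding continuous_at_sequentially
    proof safe
      fix X assume X: "X \<longlonglongrightarrow> t"
      show "(F P \<circ> X) \<longlonglongrightarrow> F P t"
        unfolding comp_def F_def
        by (rule integral_dominated_convergence[where w = "\<lambda>_. 1"]) (auto intro!: tendsto_intros X)
    qed
  qed
  have "F M 1 - F N 1 = 0"
  proof (rule exp_continuous_eq_1_imp_0[of "\<lambda>t. F M t - F N t"])
    show "continuous_on UNIV (\<lambda>t. F M t - F N t)"
      by (intro continuous_intros cont fin s)
    show "exp (F M t - F N t) = 1" for t
      using eq[of "\<lambda>i. t * a i"] by (simp add: exp_diff F_def dot_scaleR)
    show "Im (F M 0 - F N 0) = 0" by (simp add: F_def)
  qed
  then show "(CLINT x|M. iexp (dot I a x)) = (CLINT x|N. iexp (dot I a x))"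
    by (simp add: F_def)
qed

section \<open>Uniqueness of the Levy--Khintchine representation\<close>

text \<open>The formula of Levy and Khintchine without Gaussian part, for an arbitrary function \<open>\<phi>\<close>
  in the role of the characteristic function. Integrability is asked of the integrands
  only and mass at the origin is allowed, so that projections of Levy measures are included.\<close>

definition lk_representation ::
    "(real \<Rightarrow> real) \<Rightarrow> 't set \<Rightarrow> (('t \<Rightarrow> real) \<Rightarrow> complex) \<Rightarrow> ('t \<Rightarrow> real) measure \<Rightarrow> ('t \<Rightarrow> real) \<Rightarrow> bool" where
  "lk_representation \<kappa> I \<phi> \<nu> b \<longleftrightarrow> sets \<nu> = sets (real_space I) \<and>
     (\<forall>a\<in>space (real_space I). integrable \<nu> (lk_integrand \<kappa> I a) \<and>
        \<phi> a = exp ((CLINT y|\<nu>. lk_integrand \<kappa> I a y) + \<i> * complex_of_real (dot I a b)))"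

lemma lk_integrand_restrict: "lk_integrand \<kappa> I (restrict a I) = lk_integrand \<kappa> I a"
  by (simp add: lk_integrand_def dot_restrict fun_eq_iff)

text \<open>The constant and the truncation are affine in the frequency and cancel, so that the right side is a
  character times a nonnegative function of \<open>y\<close>.\<close>

lemma lk_integrand_second_difference:
  "2 * lk_integrand \<kappa> I a y - lk_integrand \<kappa> I (\<lambda>i. a i + u i) y - lk_integrand \<kappa> I (\<lambda>i. a i - u i) y
    = (2 - 2 * cos (dot I u y)) *\<^sub>R iexp (dot I a y)"
proof -
  have c: "2 * complex_of_real (cos (dot I u y)) = iexp (dot I u y) + inverse (iexp (dot I u y))"
    by (simp add: cos_of_real[symmetric] cos_exp_eq exp_minus)
  show ?thesis
    unfolding scaleR_conv_of_real of_real_diff of_real_mult of_real_numeral c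
    by (simp add: lk_integrand_def dot_add dot_diff exp_add exp_diff ring_distribs divide_inverse)
qed

text \<open>By the second difference, \<open>\<phi>\<close> determines the exponential of the Fourier transform of the finite
  measure \<open>(2 - 2 cos \<langle>u, y\<rangle>) \<nu>(dy)\<close>, hence this measure, and hence \<open>\<nu>\<close> where the density is
  positive. Frequencies along the axes of length \<open>1 / (n + 1)\<close> suffice to reach every \<open>y \<noteq> 0\<close>,
  because the cosine is less than 1 at small nonzero arguments.\<close>

lemma lk_representation_coincide_on:
  assumes I: "finite I" and r1: "lk_representation \<kappa> I \<phi> \<nu>1 b1" and r2: "lk_representation \<kappa> I \<phi> \<nu>2 b2"
  shows "coincide_on (nonzero_on I) \<nu>1 \<nu>2"
proof -
  define g where "g u y = 2 - 2 * cos (dot I u y)" for u y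
  have g0: "0 \<le> g u y" for u y by (simp add: g_def)
  have gm: "g u \<in> borel_measurable (real_space I)" for u unfolding g_def by measurable
  define \<psi> where "\<psi> a = \<phi> (restrict a I)" for a
  have s: "sets \<nu>1 = sets (real_space I)" "sets \<nu>2 = sets (real_space I)"
    using r1 r2 by (auto simp: lk_representation_def)
  have main: "finite_measure (density \<nu> (\<lambda>y. ennreal (g u y)))"
    "exp (CLINT y|density \<nu> (\<lambda>y. ennreal (g u y)). iexp (dot I a y)) =
       (\<psi> a)\<^sup>2 / (\<psi> (\<lambda>i. a i + u i) * \<psi> (\<lambda>i. a i - u i))"
    if r: "lk_representation \<kappa> I \<phi> \<nu> b" for \<nu> b a u
  proof -
    have s\<nu>: "sets \<nu> = sets (real_space I)" using r by (simp add: lk_representation_def)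
    have [measurable]: "g u \<in> borel_measurable \<nu>" "dot I a \<in> borel_measurable \<nu>" for a
      unfolding measurable_cong_sets[OF s\<nu> refl] by (rule gm dot_measurable)+
    define L where "L a = (CLINT y|\<nu>. lk_integrand \<kappa> I a y)" for a
    have int: "integrable \<nu> (lk_integrand \<kappa> I a)" 
      and \<psi>: "\<psi> a = exp (L a + \<i> * complex_of_real (dot I a b))" for a
    proof -
      have "restrict a I \<in> space (real_space I)" by (simp add: space_PiM)
      then have "integrable \<nu> (lk_integrand \<kappa> I (restrict a I)) \<and>
        \<phi> (restrict a I) = exp ((CLINT y|\<nu>. lk_integrand \<kappa> I (restrict a I) y) + \<i> * complex_of_real (dot I (restrict a I) b))"
        using r by (simp add: lk_representation_def)
      then show "integrable \<nu> (lk_integrand \<kappa> I a)" "\<psi> a = exp (L a + \<i> * complex_of_real (dot I a b))"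
        unfolding lk_integrand_restrict dot_restrict \<psi>_def L_def by auto
    qed
    have intg: "integrable \<nu> (\<lambda>y. g u y *\<^sub>R iexp (dot I a y))" for a
      unfolding g_def lk_integrand_second_difference[of \<kappa>, symmetric] using int by simp
    have "integrable \<nu> (\<lambda>y. complex_of_real (g u y))"
      using intg[of "\<lambda>_. 0"] by (simp add: dot_def scaleR_conv_of_real)
    then have ig: "integrable \<nu> (g u)" using complex_of_real_integrable_eq by blast
    have "emeasure (density \<nu> (\<lambda>y. ennreal (g u y))) (space \<nu>) = (\<integral>\<^sup>+y. ennreal (g u y) \<partial>\<nu>)"
      by (subst emeasure_density) (auto intro!: nn_integral_cong)
    also have "\<dots> = ennreal (LINT y|\<nu>. g u y)"
      using ig g0 by (intro nn_integral_eq_integral) auto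
    finally show "finite_measure (density \<nu> (\<lambda>y. ennreal (g u y)))"
      by (intro finite_measureI) auto
    have "(CLINT y|density \<nu> (\<lambda>y. ennreal (g u y)). iexp (dot I a y)) = (CLINT y|\<nu>. g u y *\<^sub>R iexp (dot I a y))"
      by (rule integral_density) (auto simp: g0)
    also have "\<dots> = 2 * L a - L (\<lambda>i. a i + u i) - L (\<lambda>i. a i - u i)"
      unfolding g_def lk_integrand_second_difference[of \<kappa>, symmetric] L_def using int by simp
    \<comment> \<open>The shift is linear in the frequency, so its second difference vanishes and can be inserted freely.\<close>
    also have "\<dots> = 2 * (L a + \<i> * complex_of_real (dot I a b))
        - (L (\<lambda>i. a i + u i) + \<i> * complex_of_real (dot I (\<lambda>i. a i + u i) b))
        - (L (\<lambda>i. a i - u i) + \<i> * complex_of_real (dot I (\<lambda>i. a i - u i) b))"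
      by (simp add: dot_add dot_diff ring_distribs)
    finally show "exp (CLINT y|density \<nu> (\<lambda>y. ennreal (g u y)). iexp (dot I a y)) =
       (\<psi> a)\<^sup>2 / (\<psi> (\<lambda>i. a i + u i) * \<psi> (\<lambda>i. a i - u i))"
      by (simp only: \<psi> exp_diff exp_double divide_divide_eq_left)
  qed
  have co: "coincide_on {y. g u y > 0} \<nu>1 \<nu>2" for u
  proof (rule coincide_on_if_density_eq)
    show "sets \<nu>1 = sets \<nu>2" using s by simp
    show "g u \<in> borel_measurable \<nu>1" using gm unfolding measurable_cong_sets[OF s(1) refl] .
    show "density \<nu>1 (\<lambda>y. ennreal (g u y)) = density \<nu>2 (\<lambda>y. ennreal (g u y))"
      by (rule finite_measure_eq_if_exp_fourier_eq[OF I main(1)[OF r1] main(1)[OF r2]])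
         (simp_all add: s main(2)[OF r1] main(2)[OF r2])
  qed
  \<comment> \<open>Along the axis of \<open>t\<close> the phase is \<open>y t / (n + 1)\<close>, which is smaller than \<open>\<pi>\<close> for large \<open>n\<close>.\<close>
  define u :: "'a \<times> nat \<Rightarrow> 'a \<Rightarrow> real" where "u = (\<lambda>(t, n) i. if i = t then inverse (real (Suc n)) else 0)"
  have "coincide_on (\<Union>c\<in>I \<times> UNIV. {y. g (u c) y > 0}) \<nu>1 \<nu>2"
  proof (rule coincide_on_countable_UN)
    show "countable (I \<times> (UNIV :: nat set))" by (rule countable_SIGMA[OF countable_finite[OF I]]) simp
    show "sets \<nu>1 = sets \<nu>2" using s by simp
    fix c show "{y. g (u c) y > 0} \<inter> space \<nu>1 \<in> sets \<nu>1"
    proof -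
      have [measurable]: "g (u c) \<in> borel_measurable \<nu>1" using gm unfolding measurable_cong_sets[OF s(1) refl] .
      have "{y. g (u c) y > 0} \<inter> space \<nu>1 = {y\<in>space \<nu>1. g (u c) y > 0}" by auto
      then show ?thesis by simp
    qed
  qed (rule co)
  moreover have "nonzero_on I \<subseteq> (\<Union>c\<in>I \<times> UNIV. {y. g (u c) y > 0})"
  proof
    fix y assume "y \<in> nonzero_on I"
    then obtain t where t: "t \<in> I" "y t \<noteq> 0" by (auto simp: nonzero_on_def)
    obtain n where n: "\<bar>y t\<bar> < real (Suc n)" using reals_Archimedean2 less_Suc_eq of_nat_Suc
      by (metis less_trans of_nat_less_iff lessI)
    define z where "z = \<bar>y t / real (Suc n)\<bar>"
    have z: "0 < z" "z < 1" using t n by (auto simp: z_def abs_mult)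
    have "dot I (u (t, n)) y = y t / real (Suc n)"
      using dot_single[OF I t(1)] by (simp add: u_def divide_inverse mult.commute)
    then have "cos (dot I (u (t, n)) y) = cos z" by (simp only: z_def cos_abs_real)
    also have "\<dots> < cos 0" using z pi_ge_two by (intro cos_monotone_0_pi) auto
    finally have "g (u (t, n)) y > 0" by (simp add: g_def)
    then show "y \<in> (\<Union>c\<in>I \<times> UNIV. {y. g (u c) y > 0})" using t by blast
  qed
  ultimately show ?thesis by (auto intro: coincide_on_subset)
qed

lemma lk_integrand_eq_0: "y \<notin> nonzero_on I \<Longrightarrow> lk_integrand \<kappa> I a y = 0"
  by (auto simp: lk_integrand_def dot_def nonzero_on_def truncation_def)

lemma lk_integrand_measurable:
  assumes [measurable]: "\<kappa> \<in> borel_measurable borel"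
  shows "lk_integrand \<kappa> I a \<in> borel_measurable (real_space I)"
proof -
  have "dot I a (truncation \<kappa> I y) = (\<Sum>t\<in>I. a t * (y t * \<kappa> (y t)))" for y
    unfolding dot_def truncation_def by (rule sum.cong) auto
  then show ?thesis unfolding lk_integrand_def by simp
qed

lemma integral_lk_integrand_coincide_on:
  assumes I: "finite I" and \<kappa>: "\<kappa> \<in> borel_measurable borel"
    and s: "sets \<nu> = sets (real_space I)" and co: "coincide_on (nonzero_on I) \<nu> \<mu>"
  shows "integrable \<nu> (lk_integrand \<kappa> I a) \<longleftrightarrow> integrable \<mu> (lk_integrand \<kappa> I a)"
    and "(CLINT y|\<nu>. lk_integrand \<kappa> I a y) = (CLINT y|\<mu>. lk_integrand \<kappa> I a y)"
proof -
  have "nonzero_on I \<inter> space \<nu> \<in> sets \<nu>"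
    using nonzero_on_measurable[OF order_refl countable_finite[OF I]] s sets_eq_imp_space_eq[OF s] by simp
  moreover have "lk_integrand \<kappa> I a \<in> borel_measurable \<nu>"
    unfolding measurable_cong_sets[OF s refl] by (rule lk_integrand_measurable[OF \<kappa>])
  ultimately show "integrable \<nu> (lk_integrand \<kappa> I a) \<longleftrightarrow> integrable \<mu> (lk_integrand \<kappa> I a)"
    "(CLINT y|\<nu>. lk_integrand \<kappa> I a y) = (CLINT y|\<mu>. lk_integrand \<kappa> I a y)"
    by (rule integral_coincide_on[OF co]; simp add: lk_integrand_eq_0)+
qed

text \<open>Once the Levy measures agree, the integrals cancel and \<open>b1 t \<noteq> b2 t\<close> would be
  detected by the frequency \<open>\<pi> / (b1 t - b2 t)\<close> on the axis of \<open>t\<close>, where the quotient of the two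
  exponentials is \<open>-1\<close>.\<close>

lemma lk_representation_shift_unique:
  assumes I: "finite I" and \<kappa>: "\<kappa> \<in> borel_measurable borel"
    and r1: "lk_representation \<kappa> I \<phi> \<nu>1 b1" and r2: "lk_representation \<kappa> I \<phi> \<nu>2 b2" and t: "t \<in> I"
  shows "b1 t = b2 t"
proof (rule ccontr)
  assume ne: "b1 t \<noteq> b2 t"
  define a where "a = (\<lambda>i\<in>I. if i = t then pi / (b1 t - b2 t) else 0)"
  have a: "a \<in> space (real_space I)" by (simp add: a_def space_PiM)
  have "sets \<nu>1 = sets (real_space I)" using r1 by (simp add: lk_representation_def)
  from integral_lk_integrand_coincide_on(2)[OF I \<kappa> this lk_representation_coincide_on[OF I r1 r2], of a]
  have "exp (\<i> * complex_of_real (dot I a b1)) = exp (\<i> * complex_of_real (dot I a b2))"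
    using r1 r2 a by (auto simp: lk_representation_def exp_add)
  then have "exp (\<i> * complex_of_real (dot I a b1 - dot I a b2)) = 1"
    by (simp add: exp_diff right_diff_distrib)
  moreover have dot: "dot I a c = pi / (b1 t - b2 t) * c t" for c
    unfolding a_def dot_restrict by (rule dot_single[OF I t])
  have "dot I a b1 - dot I a b2 = pi"
    unfolding dot right_diff_distrib[symmetric] using ne by simp
  ultimately show False by (simp add: exp_pi_i)
qed

section \<open>Poissonian processes\<close>

definition extend_zero :: "'t set \<Rightarrow> 't set \<Rightarrow> ('t \<Rightarrow> real) \<Rightarrow> 't \<Rightarrow> real" where
  "extend_zero I J a = (\<lambda>t\<in>J. if t \<in> I then a t else 0)"

lemma dot_extend_zero:
  assumes "I \<subseteq> J" "finite J"
  shows "dot J (extend_zero I J a) y = dot I a y"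
proof -
  have "dot J (extend_zero I J a) y = (\<Sum>t\<in>I. extend_zero I J a t * y t)"
    unfolding dot_def using assms by (intro sum.mono_neutral_right) (auto simp: extend_zero_def)
  also have "\<dots> = dot I a y" 
    unfolding dot_def using assms by (intro sum.cong) (auto simp: extend_zero_def)
  finally show ?thesis .
qed

lemma lk_integrand_extend_zero:
  assumes "I \<subseteq> J" "finite J"
  shows "lk_integrand \<kappa> J (extend_zero I J a) y = lk_integrand \<kappa> I a (restrict y I)"
proof -
  have "dot I a (truncation \<kappa> J y) = dot I a (truncation \<kappa> I (restrict y I))"
    unfolding dot_def truncation_def using assms by (intro sum.cong) auto
  then show ?thesis
    using assms by (simp add: lk_integrand_def dot_extend_zero dot_restrict)
qed

lemma lk_representation_distr_iff:
  assumes \<kappa>: "\<kappa> \<in> borel_measurable borel" and s: "sets \<nu> = sets (real_space T)" and I: "I \<subseteq> T"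
  shows "lk_representation \<kappa> I \<phi> (distr \<nu> (real_space I) (\<lambda>x. restrict x I)) b \<longleftrightarrow>
    (\<forall>a\<in>space (real_space I). integrable \<nu> (\<lambda>x. lk_integrand \<kappa> I a (restrict x I)) \<and>
      \<phi> a = exp ((CLINT x|\<nu>. lk_integrand \<kappa> I a (restrict x I)) + \<i> * complex_of_real (dot I a (restrict b I))))"
  unfolding lk_representation_def
  using integrable_distr_eq[OF restrict_measurable[OF s I] lk_integrand_measurable[OF \<kappa>]]
    integral_distr[OF restrict_measurable[OF s I] lk_integrand_measurable[OF \<kappa>]]
  by (simp add: dot_restrict)

text \<open>Setting the frequencies outside \<open>I\<close> to zero is the same as projecting the Levy measure to \<open>I\<close>. The
  shift is unchanged on \<open>I\<close> because the truncation acts on each coordinate separately.\<close>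

lemma lk_representation_project:
  assumes \<kappa>: "\<kappa> \<in> borel_measurable borel" and "I \<subseteq> J" "finite J"
    and r: "lk_representation \<kappa> J \<phi> \<nu> b"
    and \<phi>: "\<And>a. a \<in> space (real_space I) \<Longrightarrow> \<phi>' a = \<phi> (extend_zero I J a)"
  shows "lk_representation \<kappa> I \<phi>' (distr \<nu> (real_space I) (\<lambda>x. restrict x I)) b"
proof -
  have s: "sets \<nu> = sets (real_space J)" using r by (simp add: lk_representation_def)
  have lk: "lk_integrand \<kappa> J (extend_zero I J a) = (\<lambda>x. lk_integrand \<kappa> I a (restrict x I))" for a
    using lk_integrand_extend_zero[OF assms(2,3)] by (rule ext)
  have "extend_zero I J a \<in> space (real_space J)" for a by (simp add: extend_zero_def space_PiM)
  then show ?thesis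
    unfolding lk_representation_distr_iff[OF \<kappa> s \<open>I \<subseteq> J\<close>]
    using r assms(2,3)
    by (simp add: lk_representation_def dot_extend_zero dot_restrict \<phi> flip: lk)
qed

lemma poissonian_lk_representation:
  assumes Y: "poissonian_id_process \<kappa> T M Y" and I: "I \<in> fin_subsets T"
  shows "\<exists>\<nu> b. fd_levy_measure I \<nu> \<and>
    lk_representation \<kappa> I (\<lambda>a. CLINT \<omega>|M. exp (\<i> * complex_of_real (\<Sum>t\<in>I. a t * Y t \<omega>))) \<nu> b"
proof -
  have I': "I \<subseteq> T" using I by (simp add: fin_subsets_def)
  have [measurable]: "Y t \<in> borel_measurable M" if "t \<in> I" for t
    using Y I' that by (auto simp: poissonian_id_process_def)
  have X[measurable]: "(\<lambda>\<omega>. \<lambda>t\<in>I. Y t \<omega>) \<in> measurable M (real_space I)"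
    by measurable
  have char: "(CLINT y|distr M (real_space I) (\<lambda>\<omega>. \<lambda>t\<in>I. Y t \<omega>). iexp (dot I a y)) =
      (CLINT \<omega>|M. exp (\<i> * complex_of_real (\<Sum>t\<in>I. a t * Y t \<omega>)))" for a
    by (subst integral_distr[OF X]) (auto simp: dot_def intro!: Bochner_Integration.integral_cong)
  obtain \<nu> b where "levy_khintchine_triplet \<kappa> I (distr M (real_space I) (\<lambda>\<omega>. \<lambda>t\<in>I. Y t \<omega>)) (\<lambda>_ _. 0) \<nu> b"
    using Y I by (auto simp: poissonian_id_process_def no_gaussian_part_def)
  then show ?thesis
    unfolding levy_khintchine_triplet_def lk_representation_def char
    by (intro exI[of _ \<nu>] exI[of _ b]) (auto simp: fd_levy_measure_def)
qed

text \<open>The representation of the marginal over \<open>J\<close> projects to one over \<open>I \<subseteq> J\<close>. By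
  uniqueness of the Levy measure the marginal Levy measures are consistent, and by uniqueness of the
  shift the marginal shifts are restrictions of one function, read off from singletons. Conversely,
  a measure that represents the process has the marginal Levy measures as projections, so its
  uniqueness is that of the Levy measure of a consistent system.\<close>

lemma exists_unique_levy_representation:
  assumes \<kappa>: "\<kappa> \<in> borel_measurable borel" and Y: "poissonian_id_process \<kappa> T M Y"
  shows "\<exists>!\<nu>. levy_measure T \<nu> \<and>
          (\<exists>b \<in> space (real_space T). \<forall>I \<in> fin_subsets T. \<forall>a \<in> space (real_space I).
             integrable \<nu> (\<lambda>x. lk_integrand \<kappa> I a (restrict x I)) \<and>
             (CLINT \<omega>|M. exp (\<i> * complex_of_real (\<Sum>t\<in>I. a t * Y t \<omega>))) =
               exp ((CLINT x|\<nu>. lk_integrand \<kappa> I a (restrict x I))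
                    + \<i> * complex_of_real (dot I a (restrict b I))))"
proof -
  define \<phi> where "\<phi> I a = (CLINT \<omega>|M. exp (\<i> * complex_of_real (\<Sum>t\<in>I. a t * Y t \<omega>)))" for I a
  obtain N \<beta> where fd: "\<And>I. I \<in> fin_subsets T \<Longrightarrow> fd_levy_measure I (N I)"
    and rep: "\<And>I. I \<in> fin_subsets T \<Longrightarrow> lk_representation \<kappa> I (\<phi> I) (N I) (\<beta> I)"
  proof -
    have "\<And>I. I \<in> fin_subsets T \<Longrightarrow> \<exists>\<nu> b. fd_levy_measure I \<nu> \<and> lk_representation \<kappa> I (\<phi> I) \<nu> b"
      unfolding \<phi>_def by (rule poissonian_lk_representation[OF Y])
    then show ?thesis using that by metis
  qed
  have rep_J: "lk_representation \<kappa> I (\<phi> I) (distr (N J) (real_space I) (\<lambda>x. restrict x I)) (\<beta> J)"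
    if I: "I \<in> fin_subsets T" and J: "J \<in> fin_subsets T" and "I \<subseteq> J" for I J
  proof (rule lk_representation_project[OF \<kappa> \<open>I \<subseteq> J\<close> _ rep[OF J]])
    show "finite J" using J by (simp add: fin_subsets_def)
    then show "\<phi> I a = \<phi> J (extend_zero I J a)" for a
      using dot_extend_zero[OF \<open>I \<subseteq> J\<close>, of a "\<lambda>t. Y t _"] by (simp add: \<phi>_def dot_def)
  qed
  have cons: "consistent_levy_system T N"
    unfolding consistent_levy_system_def
  proof (intro conjI ballI impI fd)
    fix I J B assume IJ: "I \<in> fin_subsets T" "J \<in> fin_subsets T" "I \<subseteq> J" and B: "B \<in> sets_off_origin I"
    have "coincide_on (nonzero_on I) (distr (N J) (real_space I) (\<lambda>x. restrict x I)) (N I)"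
      using lk_representation_coincide_on[OF _ rep_J[OF IJ] rep[OF IJ(1)]] fin_subsetsD[OF IJ(1)] by simp
    then show "emeasure (distr (N J) (real_space I) (\<lambda>x. restrict x I)) B = emeasure (N I) B"
      using B by (intro coincide_onD) (auto simp: sets_off_origin_iff)
  qed
  have sN: "sets (N I) = sets (real_space I)" if "I \<in> fin_subsets T" for I
    using fd[OF that] by (simp add: fd_levy_measure_def)
  define b where "b = (\<lambda>t\<in>T. \<beta> {t} t)"
  have b: "b t = \<beta> I t" if I: "I \<in> fin_subsets T" and t: "t \<in> I" for I t
  proof -
    have t': "{t} \<in> fin_subsets T" "{t} \<subseteq> I" "t \<in> T" using that by (auto simp: fin_subsets_def)
    show ?thesis
      using lk_representation_shift_unique[OF _ \<kappa> rep_J[OF t'(1) I t'(2)] rep[OF t'(1)], of t] t' by (simp add: b_def)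
  qed
  have rep_b: "lk_representation \<kappa> I (\<phi> I) (N I) b" if I: "I \<in> fin_subsets T" for I
  proof -
    have "dot I a b = dot I a (\<beta> I)" for a unfolding dot_def using b[OF I] by (intro sum.cong) auto
    then show ?thesis using rep[OF I] by (simp add: lk_representation_def)
  qed
  have main: "(\<forall>I \<in> fin_subsets T. \<forall>a \<in> space (real_space I).
       integrable \<nu> (\<lambda>x. lk_integrand \<kappa> I a (restrict x I)) \<and>
       \<phi> I a = exp ((CLINT x|\<nu>. lk_integrand \<kappa> I a (restrict x I)) + \<i> * complex_of_real (dot I a (restrict c I))))
     \<longleftrightarrow> (\<forall>I \<in> fin_subsets T. lk_representation \<kappa> I (\<phi> I) (distr \<nu> (real_space I) (\<lambda>x. restrict x I)) c)"
    if "sets \<nu> = sets (real_space T)" for \<nu> c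
    using lk_representation_distr_iff[OF \<kappa> that] fin_subsetsD[of _ T] by auto
  have levyD: "sets \<nu> = sets (real_space T)" if "levy_measure T \<nu>" for \<nu>
    using that by (simp add: levy_measure_def)
  show ?thesis
    unfolding \<phi>_def[symmetric]
  proof (rule ex_ex1I)
    obtain \<nu> where \<nu>: "levy_measure T \<nu>" "has_projections T N \<nu>" using exists_levy_measure[OF cons] by blast
    note s = levyD[OF \<nu>(1)]
    have "lk_representation \<kappa> I (\<phi> I) (distr \<nu> (real_space I) (\<lambda>x. restrict x I)) b" if I: "I \<in> fin_subsets T" for I
    proof -
      have "coincide_on (nonzero_on I) (distr \<nu> (real_space I) (\<lambda>x. restrict x I)) (N I)"
        using \<nu>(2) has_projections_iff_coincide_on[OF s sN] I by blast
      from integral_lk_integrand_coincide_on[OF _ \<kappa> _ this]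
      show ?thesis
        using rep_b[OF I] fin_subsetsD[OF I] by (simp add: lk_representation_def)
    qed
    moreover have "b \<in> space (real_space T)" by (simp add: b_def space_PiM)
    ultimately show "\<exists>\<nu>. levy_measure T \<nu> \<and> (\<exists>b \<in> space (real_space T). \<forall>I \<in> fin_subsets T. \<forall>a \<in> space (real_space I).
       integrable \<nu> (\<lambda>x. lk_integrand \<kappa> I a (restrict x I)) \<and>
       \<phi> I a = exp ((CLINT x|\<nu>. lk_integrand \<kappa> I a (restrict x I)) + \<i> * complex_of_real (dot I a (restrict b I))))"
      using \<nu>(1) main[OF s] by blast
  next
    have proj: "has_projections T N \<nu>" if "levy_measure T \<nu>" and
      "\<forall>I \<in> fin_subsets T. \<forall>a \<in> space (real_space I). integrable \<nu> (\<lambda>x. lk_integrand \<kappa> I a (restrict x I)) \<and>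
       \<phi> I a = exp ((CLINT x|\<nu>. lk_integrand \<kappa> I a (restrict x I)) + \<i> * complex_of_real (dot I a (restrict c I)))"
      for \<nu> c
    proof (rule has_projections_iff_coincide_on[OF levyD[OF that(1)], THEN iffD2, OF sN], assumption, rule ballI)
      fix I assume I: "I \<in> fin_subsets T"
      have "lk_representation \<kappa> I (\<phi> I) (distr \<nu> (real_space I) (\<lambda>x. restrict x I)) c"
        using that(2) main[OF levyD[OF that(1)]] I by blast
      from lk_representation_coincide_on[OF _ this rep[OF I]]
      show "coincide_on (nonzero_on I) (distr \<nu> (real_space I) (\<lambda>x. restrict x I)) (N I)"
        using fin_subsetsD[OF I] by simp
    qed
    fix \<nu> \<mu>
    assume \<nu>: "levy_measure T \<nu> \<and> (\<exists>b \<in> space (real_space T). \<forall>I \<in> fin_subsets T. \<forall>a \<in> space (real_space I).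
       integrable \<nu> (\<lambda>x. lk_integrand \<kappa> I a (restrict x I)) \<and>
       \<phi> I a = exp ((CLINT x|\<nu>. lk_integrand \<kappa> I a (restrict x I)) + \<i> * complex_of_real (dot I a (restrict b I))))"
      and \<mu>: "levy_measure T \<mu> \<and> (\<exists>b \<in> space (real_space T). \<forall>I \<in> fin_subsets T. \<forall>a \<in> space (real_space I).
       integrable \<mu> (\<lambda>x. lk_integrand \<kappa> I a (restrict x I)) \<and>
       \<phi> I a = exp ((CLINT x|\<mu>. lk_integrand \<kappa> I a (restrict x I)) + \<i> * complex_of_real (dot I a (restrict b I))))"
    have "has_projections T N \<nu>" using \<nu> by (elim conjE bexE) (rule proj)
    moreover have "has_projections T N \<mu>" using \<mu> by (elim conjE bexE) (rule proj)
    ultimately show "\<nu> = \<mu>"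
      using levy_measure_unique[OF cons] \<nu> \<mu> by simp
  qed
qed

theorem theorem2p8:
  fixes T :: "'t set" and \<kappa> :: "real \<Rightarrow> real"
  assumes "T \<noteq> {}" and "cutoff_function \<kappa>"
  shows
    "(\<forall>(M :: 'w measure) (Y :: 't \<Rightarrow> 'w \<Rightarrow> real). poissonian_id_process \<kappa> T M Y \<longrightarrow>
        (\<exists>!\<nu>. levy_measure T \<nu> \<and>
          (\<exists>b \<in> space (real_space T). \<forall>I \<in> fin_subsets T. \<forall>a \<in> space (real_space I).
             integrable \<nu> (\<lambda>x. lk_integrand \<kappa> I a (restrict x I)) \<and>
             (CLINT \<omega>|M. exp (\<i> * complex_of_real (\<Sum>t\<in>I. a t * Y t \<omega>))) =
               exp ((CLINT x|\<nu>. lk_integrand \<kappa> I a (restrict x I))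
                    + \<i> * complex_of_real (dot I a (restrict b I))))))
     \<and>
     (\<forall>N :: 't set \<Rightarrow> ('t \<Rightarrow> real) measure. consistent_levy_system T N \<longrightarrow>
        (\<exists>!\<nu>. levy_measure T \<nu> \<and> has_projections T N \<nu>) \<and>
        (\<forall>\<nu> \<rho>. levy_measure T \<nu> \<and> has_projections T N \<nu> \<and>
               sets \<rho> = sets (real_space T) \<and> has_projections T N \<rho> \<longrightarrow>
           (\<forall>A \<in> sets (real_space T).
              emeasure \<nu> A = origin_removed T \<rho> A \<and>
              origin_removed T \<rho> A \<le> emeasure \<rho> A)))"
proof (intro conjI allI impI)
  fix M :: "'w measure" and Y :: "'t \<Rightarrow> 'w \<Rightarrow> real"
  assume "poissonian_id_process \<kappa> T M Y"
  moreover have "\<kappa> \<in> borel_measurable borel" using assms(2) by (simp add: cutoff_function_def)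
  ultimately show "\<exists>!\<nu>. levy_measure T \<nu> \<and>
          (\<exists>b \<in> space (real_space T). \<forall>I \<in> fin_subsets T. \<forall>a \<in> space (real_space I).
             integrable \<nu> (\<lambda>x. lk_integrand \<kappa> I a (restrict x I)) \<and>
             (CLINT \<omega>|M. exp (\<i> * complex_of_real (\<Sum>t\<in>I. a t * Y t \<omega>))) =
               exp ((CLINT x|\<nu>. lk_integrand \<kappa> I a (restrict x I))
                    + \<i> * complex_of_real (dot I a (restrict b I))))"
    by (rule exists_unique_levy_representation[rotated])
next
  fix N :: "'t set \<Rightarrow> ('t \<Rightarrow> real) measure"
  assume cons: "consistent_levy_system T N"
  show "\<exists>!\<nu>. levy_measure T \<nu> \<and> has_projections T N \<nu>"
    using exists_levy_measure[OF cons] levy_measure_unique[OF cons] by blast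
  fix \<nu> \<rho> assume *: "levy_measure T \<nu> \<and> has_projections T N \<nu> \<and>
               sets \<rho> = sets (real_space T) \<and> has_projections T N \<rho>"
  then have s: "sets \<nu> = sets (real_space T)" by (simp add: levy_measure_def)
  show "\<forall>A \<in> sets (real_space T). emeasure \<nu> A = origin_removed T \<rho> A \<and> origin_removed T \<rho> A \<le> emeasure \<rho> A"
  proof (intro ballI conjI)
    fix A assume A: "A \<in> sets (real_space T)"
    have "emeasure \<nu> A = inner_measure \<nu> (A - {origin T})" using * A by (simp add: levy_measure_def)
    also have "\<dots> = origin_removed T \<rho> A"
      unfolding origin_removed_def using * s
      by (intro inner_measure_coincide_on has_projections_coincide_on[OF cons]) auto
    finally show "emeasure \<nu> A = origin_removed T \<rho> A" .
    show "origin_removed T \<rho> A \<le> emeasure \<rho> A"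
      unfolding origin_removed_def inner_measure_def using A * by (intro SUP_least emeasure_mono) auto
  qed
qed

end
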